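(* Let $d\ge1$, let $p\ge2$ be an even integer, let $\langle\gamma\rangle\in\mathbb{R}\setminus\{0\}$, and let $s_m=\frac d2-\frac2p$. For Schwartz $\phi$ on $\mathbb{R}^d$ define $$[\Xi_1(\phi)](t)=i\int_0^t\int_0^1 e^{i\langle\gamma\rangle(t-\tau)\Delta-i\sigma\Delta}\Big[\big|e^{i(\langle\gamma\rangle\tau+\sigma)\Delta}\phi\big|^p\, e^{i(\langle\gamma\rangle\tau+\sigma)\Delta}\phi\Big]\,d\sigma\,d\tau .$$ Then for any $T>0$ and any $s<s_m$, the operator $\Xi_1$ (the $(p+1)$st derivative at zero of the data-to-solution map of the Gabitov--Turitsyn equation) fails to be bounded $H^s\to L^\infty_tH^s_x((-T,T))$ for Schwartz data; that is, there is no constant $C<\infty$ such that $$\|\Xi_1(\phi)\|_{L^\infty_tH^s_x((-T,T)\times\mathbb{R}^d)}\le C\,\|\phi\|_{H^s}^{p+1}\qquad\text{for all }\phi\in\mathcal{S}(\mathbb{R}^d).$$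
   Context: The Gabitov--Turitsyn equation is $$ i u_t+\langle\gamma\rangle\Delta u+\int_0^1 e^{-i\sigma\Delta}\Big[\big|e^{i\sigma\Delta}u\big|^p\, e^{i\sigma\Delta}u\Big]\,d\sigma=0,\qquad u(0,x)=u_0(x).$$ For $u_0=\delta\phi$ with $\phi$ Schwartz and corresponding local solution $u=u(\delta,\phi)$, $\Xi_1(\phi)$ is (up to the numerical factor $(p+1)!$) the derivative $\partial_\delta^{p+1}u|_{\delta=0}$, i.e. the $(p+1)$st directional derivative of the data-to-solution map at $0$ in the direction $\phi$. The norm of $H^s(\mathbb{R}^d)$ is $\|f\|_{H^s}^2=\int(1+|\xi|^2)^s|\widehat f(\xi)|^2d\xi$. *)

theory Defs
  imports "HOL-Probability.Probability"
begin

text \<open>Iterated partial derivatives along a list of (basis) vectors. For functions all of whose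
  iterated partial derivatives are differentiable, lists of basis vectors play the role of
  multi-indices.\<close>

fun iter_deriv :: "'a list \<Rightarrow> ('a::euclidean_space \<Rightarrow> complex) \<Rightarrow> 'a \<Rightarrow> complex" where
  "iter_deriv [] f = f"
| "iter_deriv (b # bs) f = (\<lambda>x. frechet_derivative (iter_deriv bs f) (at x) b)"

definition schwartz :: "('a::euclidean_space \<Rightarrow> complex) \<Rightarrow> bool" where
  "schwartz f \<longleftrightarrow>
     (\<forall>bs. set bs \<subseteq> Basis \<longrightarrow>
        (\<forall>x. iter_deriv bs f differentiable (at x)) \<and>
        (\<forall>k::nat. bounded (range (\<lambda>x. (1 + norm x) ^ k *\<^sub>R iter_deriv bs f x))))"

text \<open>Unitary normalisation of the Fourier transform. Since Bochner integrals of non-integrable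
  functions are 0, these definitions are meaningful for integrable functions only.\<close>

definition fourier :: "('a::euclidean_space \<Rightarrow> complex) \<Rightarrow> 'a \<Rightarrow> complex" where
  "fourier f \<xi> =
     complex_of_real ((2 * pi) powr (- real DIM('a) / 2)) * (LBINT x. cis (- (x \<bullet> \<xi>)) * f x)"

definition inv_fourier :: "('a::euclidean_space \<Rightarrow> complex) \<Rightarrow> 'a \<Rightarrow> complex" where
  "inv_fourier g x =
     complex_of_real ((2 * pi) powr (- real DIM('a) / 2)) * (LBINT \<xi>. cis (x \<bullet> \<xi>) * g \<xi>)"

text \<open>The free Schroedinger propagator \<open>exp (i t \<Delta>)\<close>, as the Fourier multiplier
  \<open>exp (- i t |\<xi>|^2)\<close>.\<close>

definition schroedinger :: "real \<Rightarrow> ('a::euclidean_space \<Rightarrow> complex) \<Rightarrow> 'a \<Rightarrow> complex" where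
  "schroedinger t f = inv_fourier (\<lambda>\<xi>. cis (- t * (norm \<xi>)\<^sup>2) * fourier f \<xi>)"

text \<open>Sobolev norms take values in \<^typ>\<open>ennreal\<close>, so that an infinite norm is not confused
  with a junk value.\<close>

definition sobolev_norm :: "real \<Rightarrow> ('a::euclidean_space \<Rightarrow> complex) \<Rightarrow> ennreal" where
  "sobolev_norm s f =
     (let I = (\<integral>\<^sup>+ \<xi>. ennreal ((1 + (norm \<xi>)\<^sup>2) powr s * (norm (fourier f \<xi>))\<^sup>2) \<partial>lborel)
      in if I = \<infinity> then \<infinity> else ennreal (sqrt (enn2real I)))"

definition Linf_sobolev_norm ::
    "real \<Rightarrow> real \<Rightarrow> (real \<Rightarrow> 'a::euclidean_space \<Rightarrow> complex) \<Rightarrow> ennreal" where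
  "Linf_sobolev_norm T s u =
     esssup (restrict_space lborel {-T<..<T}) (\<lambda>t. sobolev_norm s (u t))"

definition power_nonlinearity :: "nat \<Rightarrow> ('a \<Rightarrow> complex) \<Rightarrow> 'a \<Rightarrow> complex" where
  "power_nonlinearity p f x = complex_of_real (norm (f x) ^ p) * f x"

text \<open>The integrals are oriented, so that negative times are covered.\<close>

definition Xi1 ::
    "real \<Rightarrow> nat \<Rightarrow> ('a::euclidean_space \<Rightarrow> complex) \<Rightarrow> real \<Rightarrow> 'a \<Rightarrow> complex" where
  "Xi1 \<gamma> p \<phi> t x =
     \<i> * (LBINT \<tau>=0..t. (LBINT \<sigma>=0..1.
            schroedinger (\<gamma> * (t - \<tau>) - \<sigma>)
              (power_nonlinearity p (schroedinger (\<gamma> * \<tau> + \<sigma>) \<phi>)) x))"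

end

theory Submission
  imports Defs "HOL-Complex_Analysis.Conformal_Mappings" "HOL-Real_Asymp.Real_Asymp"
begin

text \<open>For a datum \<open>\<phi>\<close> let \<open>u(r)\<close> be its free evolution. By Parseval, the pairing of \<open>Xi1(\<phi>)(t)\<close> with
  \<open>u(\<gamma> t)\<close> is, up to a unimodular factor, the integral of \<open>|u(\<gamma> \<tau> + \<sigma>)| ^ (p + 2)\<close> over \<open>x\<close>, \<open>\<sigma>\<close> and
  \<open>\<tau>\<close>, and it is at most the product of the \<open>H^s\<close> norm of \<open>Xi1(\<phi>)(t)\<close> and the \<open>H^(-s)\<close> norm of
  \<open>\<phi>\<close>. Take \<open>\<phi>\<close> to be a Gaussian of width \<open>1 / N\<close> modulated to the frequency \<open>M One\<close>
  with \<open>M = N^(1 + \<epsilon>)\<close>. It stays concentrated for \<open>|r| \<le> N^(-2)\<close>, where the space integral is of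
  order \<open>N^(-d)\<close>. If \<open>\<gamma> t < 0\<close>, the phase \<open>\<gamma> \<tau> + \<sigma>\<close> lies in this window on a set of area of order
  \<open>N^(-2)\<close>, so the pairing is at least of order \<open>N^(-d - 2)\<close>. As \<open>M\<close> is much larger than \<open>N\<close>, the
  \<open>H^r\<close> norm of \<open>\<phi>\<close> is at most of order \<open>M^r N^(-d / 2)\<close> for every real \<open>r\<close>, of either sign. A bound for \<open>Xi1\<close>
  would therefore give \<open>N^(-d - 2) \<le> C M^(p s) N^(-d (p + 2) / 2)\<close>, which fails for large \<open>N\<close> as soon as
  \<open>(1 + \<epsilon>) s < d / 2 - 2 / p\<close>.\<close>

section \<open>Gaussian integrals on the real line\<close>

text \<open>The exponent 2 / p in the threshold comes from a strip. The pairs (\<tau>, \<sigma>)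
  whose phase is within N^(-2) of 0 fill a strip of length of order 1 and width N^(-2), so the
  average over \<sigma> costs no more than the factor N^(-2) already forced by dispersion of a
  packet of width 1 / N. The sign of \<gamma> t is what lets a positive \<sigma> cancel \<gamma>
  \<tau>. The modulation serves the norms. Without it, for s < - d / 2, frequencies of order 1
  dominate the H^s norm of a bump of width 1 / N and make it much larger than N^(s - d / 2). By
  Galilean invariance the modulation only translates the modulus of the evolution, so the lower
  bound does not see M. A Gaussian keeps a frequency tail near the origin, where the weight differs
  from its central value by a power of N; with M = N^(1 + \<epsilon>) this tail is smaller than
  every power of N, with M of order N it is not. Gaussians are chosen because the propagator and the
  nonlinearity act on them through explicit formulas for the parameters, so that inversion and every
  use of Fubini can be checked within one class.\<close>

lemma norm_cexp_quadratic:
  fixes a \<beta> :: complex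
  shows "norm (exp (- a * of_real (x\<^sup>2) + \<beta> * of_real x)) = exp (- Re a * x\<^sup>2 + Re \<beta> * x)"
  by simp

lemma integrable_exp_quadratic:
  fixes a b :: real
  assumes "a > 0"
  shows "integrable lborel (\<lambda>x. exp (- a * x\<^sup>2 + b * x))"
proof -
  define \<sigma> where "\<sigma> = 1 / sqrt (2 * a)"
  have \<sigma>: "\<sigma> > 0" "\<sigma>\<^sup>2 = 1 / (2 * a)"
    using assms by (auto simp: \<sigma>_def power_divide)
  have "integrable lborel (\<lambda>x. (sqrt (2 * pi * \<sigma>\<^sup>2) * exp (b\<^sup>2 / (4 * a))) *
                               normal_density (b / (2 * a)) \<sigma> x)"
    using \<sigma> by (intro integrable_mult_right integrable_normal_density) auto
  moreover have "(sqrt (2 * pi * \<sigma>\<^sup>2) * exp (b\<^sup>2 / (4 * a))) * normal_density (b / (2 * a)) \<sigma> x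
                   = exp (- a * x\<^sup>2 + b * x)" for x
  proof -
    have "b\<^sup>2 / (4 * a) + (- (x - b / (2 * a))\<^sup>2 / (2 * \<sigma>\<^sup>2)) = - a * x\<^sup>2 + b * x"
      unfolding \<sigma>(2) using assms by (simp add: power2_eq_square field_simps)
    moreover have "sqrt (2 * pi * \<sigma>\<^sup>2) \<noteq> 0" using \<sigma>(1) by simp
    ultimately show ?thesis
      unfolding normal_density_def by (simp flip: exp_add)
  qed
  ultimately show ?thesis by simp
qed

lemma integrable_cexp_quadratic:
  fixes a \<beta> :: complex
  assumes "Re a > 0"
  shows "integrable lborel (\<lambda>x::real. exp (- a * of_real (x\<^sup>2) + \<beta> * of_real x))"
proof (rule Bochner_Integration.integrable_bound)
  show "integrable lborel (\<lambda>x. exp (- Re a * x\<^sup>2 + Re \<beta> * x))"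
    by (rule integrable_exp_quadratic[OF assms])
qed (auto simp del: of_real_power)

text \<open>Only \<open>Re \<beta>\<close> enters the completed square; \<open>Im \<beta>\<close>,
  after scaling, becomes the argument of the characteristic function of the standard normal
  distribution.\<close>

lemma integral_cexp_quadratic_real:
  fixes a :: real and \<beta> :: complex
  assumes "a > 0"
  shows "(LBINT x. exp (- of_real a * of_real (x\<^sup>2) + \<beta> * of_real x))
           = of_real (sqrt pi) / csqrt (of_real a) * exp (\<beta>\<^sup>2 / (4 * of_real a))"
proof -
  define b c where "b = Re \<beta>" and "c = Im \<beta>"
  have \<beta>: "\<beta> = of_real b + \<i> * of_real c" by (simp add: b_def c_def complex_eq_iff)
  \<comment> \<open>The substitution \<open>t + k * x\<close> moves the maximum of the real part of
    the exponent to 0 and rescales the variance to 1.\<close>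
  define t k where "t = b / (2 * a)" and "k = 1 / sqrt (2 * a)"
  have k: "k > 0" "k\<^sup>2 = 1 / (2 * a)" using assms by (auto simp: k_def power_divide)
  have char: "(LBINT x. of_real (exp (- x\<^sup>2 / 2)) * exp (\<i> * of_real (c * k * x)))
                = of_real (sqrt (2 * pi) * exp (- (c * k)\<^sup>2 / 2))"
  proof -
    have "of_real (exp (- (c * k)\<^sup>2 / 2)) = char std_normal_distribution (c * k)"
      by (simp add: char_std_normal_distribution)
    also have "\<dots> = (LBINT x. std_normal_density x *\<^sub>R exp (\<i> * of_real (c * k * x)))"
      unfolding char_def by (subst integral_density) (auto simp: normal_density_nonneg)
    also have "\<dots> = (LBINT x. (1 / sqrt (2 * pi)) *\<^sub>R
                     (of_real (exp (- x\<^sup>2 / 2)) * exp (\<i> * of_real (c * k * x))))"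
      by (simp add: std_normal_density_def scaleR_conv_of_real mult.assoc)
    also have "\<dots> = (1 / sqrt (2 * pi)) *\<^sub>R
                     (LBINT x. of_real (exp (- x\<^sup>2 / 2)) * exp (\<i> * of_real (c * k * x)))"
      by (rule integral_scaleR_right)
    finally show ?thesis
      by (simp add: scaleR_conv_of_real field_simps)
  qed
  have "(LBINT x. exp (- of_real a * of_real (x\<^sup>2) + \<beta> * of_real x))
      = \<bar>k\<bar> *\<^sub>R (LBINT x. exp (- of_real a * of_real ((t + k * x)\<^sup>2) + \<beta> * of_real (t + k * x)))"
    by (rule lborel_integral_real_affine) (use k in auto)
  also have "(\<lambda>x. exp (- of_real a * of_real ((t + k * x)\<^sup>2) + \<beta> * of_real (t + k * x)))
     = (\<lambda>x. exp (of_real (b\<^sup>2 / (4 * a)) + \<i> * of_real (c * t)) *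
            (of_real (exp (- x\<^sup>2 / 2)) * exp (\<i> * of_real (c * k * x))))"
  proof
    fix x
    have re: "- a * (t + k * x)\<^sup>2 + b * (t + k * x) = b\<^sup>2 / (4 * a) - x\<^sup>2 / 2"
    proof -
      have "- a * (t + k * x)\<^sup>2 + b * (t + k * x)
            = (- a * t\<^sup>2 + b * t) + (b - 2 * a * t) * k * x - a * k\<^sup>2 * x\<^sup>2"
        by (simp add: power2_eq_square algebra_simps)
      also have "\<dots> = b\<^sup>2 / (4 * a) - x\<^sup>2 / 2"
        unfolding t_def k(2) using assms by (simp add: power2_eq_square field_simps)
      finally show ?thesis .
    qed
    have "- of_real a * of_real ((t + k * x)\<^sup>2) + \<beta> * of_real (t + k * x)
        = complex_of_real (- a * (t + k * x)\<^sup>2 + b * (t + k * x)) + \<i> * of_real (c * (t + k * x))"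
      by (simp add: \<beta> algebra_simps)
    also have "\<dots> = (of_real (b\<^sup>2 / (4 * a)) + \<i> * of_real (c * t)) +
                     (of_real (- x\<^sup>2 / 2) + \<i> * of_real (c * k * x))"
      unfolding re by (simp add: algebra_simps)
    finally show "exp (- of_real a * of_real ((t + k * x)\<^sup>2) + \<beta> * of_real (t + k * x))
       = exp (of_real (b\<^sup>2 / (4 * a)) + \<i> * of_real (c * t)) *
            (of_real (exp (- x\<^sup>2 / 2)) * exp (\<i> * of_real (c * k * x)))"
      by (simp only: exp_add exp_of_real)
  qed
  also have "\<bar>k\<bar> *\<^sub>R (LBINT x. exp (of_real (b\<^sup>2 / (4 * a)) + \<i> * of_real (c * t)) *
            (of_real (exp (- x\<^sup>2 / 2)) * exp (\<i> * of_real (c * k * x))))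
      = of_real (k * sqrt (2 * pi)) * (exp (of_real (b\<^sup>2 / (4 * a)) + \<i> * of_real (c * t))
          * of_real (exp (- (c * k)\<^sup>2 / 2)))"
    using k(1) by (subst integral_mult_right_zero, subst char) (simp add: scaleR_conv_of_real)
  also have "k * sqrt (2 * pi) = sqrt pi / sqrt a"
    using assms by (simp add: k_def real_sqrt_mult)
  also have "exp (of_real (b\<^sup>2 / (4 * a)) + \<i> * of_real (c * t)) * of_real (exp (- (c * k)\<^sup>2 / 2))
      = exp (\<beta>\<^sup>2 / (4 * of_real a))"
  proof -
    have ck: "- (c * k)\<^sup>2 / 2 = - c\<^sup>2 / (4 * a)" by (simp add: power_mult_distrib k(2))
    have "of_real (b\<^sup>2 / (4 * a)) + \<i> * of_real (c * t) + of_real (- (c * k)\<^sup>2 / 2)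
        = \<beta>\<^sup>2 / (4 * of_real a)"
      unfolding ck using assms
      by (simp add: \<beta> t_def power2_eq_square field_simps)
    then show ?thesis by (simp only: exp_add[symmetric] exp_of_real[symmetric])
  qed
  also have "of_real (sqrt pi / sqrt a) = of_real (sqrt pi) / csqrt (of_real a)"
    using assms by simp
  finally show ?thesis .
qed

text \<open>A locally uniform limit of the integrals over \<open>[-n, n]\<close>, each holomorphic
  by differentiation under the integral sign.\<close>

lemma holomorphic_integral_cexp_quadratic:
  "(\<lambda>z. LBINT x::real. exp (- z * of_real (x\<^sup>2) + \<beta> * of_real x)) holomorphic_on {z. Re z > 0}"
proof (rule holomorphic_uniform_sequence)
  define f where "f = (\<lambda>(z::complex) (x::real). exp (- z * of_real (x\<^sup>2) + \<beta> * of_real x))"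
  show "open {z. Re z > 0}" by (rule open_halfspace_Re_gt)
  show "(\<lambda>z. integral (cbox (- real n) (real n)) (f z)) holomorphic_on {z. Re z > 0}" for n
  proof (rule leibniz_rule_holomorphic)
    show "((\<lambda>z. f z t) has_field_derivative f z t * (- of_real (t\<^sup>2))) (at z within {z. Re z > 0})"
      for z t
      unfolding f_def by (auto intro!: derivative_eq_intros)
    show "f z integrable_on cbox (- real n) (real n)" for z
      unfolding f_def by (intro integrable_continuous continuous_intros)
    show "continuous_on ({z. Re z > 0} \<times> cbox (- real n) (real n))
            (\<lambda>(z, t). f z t * (- of_real (t\<^sup>2)))"
      unfolding f_def case_prod_unfold by (intro continuous_intros)
    show "convex {z. Re z > 0}" by (rule convex_halfspace_Re_gt)
  qed
  fix z :: complex assume "z \<in> {z. Re z > 0}"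
  then have z: "Re z > 0" by simp
  \<comment> \<open>Half the distance to the imaginary axis: a single real Gaussian of rate
    \<open>d\<close> then dominates the integrands for all \<open>w\<close> in the closed
    ball.\<close>
  define d where "d = Re z / 2"
  have Re_ge: "Re w \<ge> d" if "w \<in> cball z d" for w
  proof -
    have "Re z - Re w \<le> d"
      using that abs_Re_le_cmod[of "z - w"] by (simp add: dist_norm)
    then show ?thesis by (simp add: d_def)
  qed
  define g where "g = (\<lambda>x::real. exp (- d * x\<^sup>2 + Re \<beta> * x))"
  have d: "d > 0" using z by (simp add: d_def)
  have g: "integrable lborel g" unfolding g_def by (rule integrable_exp_quadratic[OF d])
  have bound: "norm (f w x) \<le> g x" if "w \<in> cball z d" for w x
    using Re_ge[OF that] unfolding f_def g_def norm_cexp_quadratic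
    by (auto intro!: mult_right_mono)
  have int_f: "integrable lborel (f w)" if "w \<in> cball z d" for w
    unfolding f_def using Re_ge[OF that] d by (intro integrable_cexp_quadratic) auto
  \<comment> \<open>The tail integral of the majorant \<open>g\<close> bounds the truncation error
    for all \<open>w\<close> in the ball at once, which makes the convergence uniform.\<close>
  have lim: "(\<lambda>n. LBINT x. indicator (- {- real n..real n}) x * g x) \<longlonglongrightarrow> (LBINT x::real. 0)"
  proof (rule integral_dominated_convergence[where w = "\<lambda>x. norm (g x)"])
    show "AE x in lborel. (\<lambda>n. indicator (- {- real n..real n}) x * g x) \<longlonglongrightarrow> 0"
    proof (rule AE_I2)
      fix x :: real
      obtain m :: nat where m: "\<bar>x\<bar> \<le> real m" using real_arch_simple by blast
      have "indicator (- {- real n..real n}) x * g x = 0" if "n \<ge> m" for n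
        using m that by (auto simp: indicator_def)
      then have "eventually (\<lambda>n. indicator (- {- real n..real n}) x * g x = 0) sequentially"
        unfolding eventually_sequentially by blast
      then show "(\<lambda>n. indicator (- {- real n..real n}) x * g x) \<longlonglongrightarrow> 0"
        by (rule tendsto_eventually)
    qed
  qed (use g in \<open>auto simp: indicator_def\<close>)
  have *: "norm (integral (cbox (- real n) (real n)) (f w) - (LBINT x. f w x))
          \<le> (LBINT x. indicator (- {- real n..real n}) x * g x)" if w: "w \<in> cball z d" for n w
  proof -
    have si: "set_integrable lborel {- real n..real n} (f w)"
      unfolding set_integrable_def by (intro integrable_mult_indicator int_f w) auto
    then have "integral (cbox (- real n) (real n)) (f w) = (LBINT x:{- real n..real n}. f w x)"
      by (simp add: set_borel_integral_eq_integral)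
    also have "\<dots> - (LBINT x. f w x)
        = (LBINT x. indicator {- real n..real n} x *\<^sub>R f w x - f w x)"
      unfolding set_lebesgue_integral_def
      using si int_f[OF w] by (subst Bochner_Integration.integral_diff) (auto simp: set_integrable_def)
    also have "norm \<dots> \<le> (LBINT x. indicator (- {- real n..real n}) x * g x)"
    proof (rule Bochner_Integration.integral_norm_bound_integral)
      show "integrable lborel (\<lambda>x. indicator (- {- real n..real n}) x * g x)"
        using integrable_mult_indicator[OF _ g, of "- {- real n..real n}"] by simp
      show "integrable lborel (\<lambda>x. indicator {- real n..real n} x *\<^sub>R f w x - f w x)"
        using si int_f[OF w] by (auto simp: set_integrable_def)
    qed (use bound[OF w] in \<open>auto simp: indicator_def\<close>)
    finally show ?thesis .
  qed
  have "uniform_limit (cball z d) (\<lambda>n w. integral (cbox (- real n) (real n)) (f w))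
          (\<lambda>w. LBINT x. f w x) sequentially"
  proof (rule uniform_limitI)
    fix e :: real assume "e > 0"
    then have "eventually (\<lambda>n. (LBINT x. indicator (- {- real n..real n}) x * g x) < e) sequentially"
      using order_tendstoD(2)[OF lim, of e] by simp
    then show "\<forall>\<^sub>F n in sequentially. \<forall>w\<in>cball z d.
        dist (integral (cbox (- real n) (real n)) (f w)) (LBINT x. f w x) < e"
    proof eventually_elim
      case (elim n)
      show ?case
        unfolding dist_norm using *[of _ n] elim by (blast intro: le_less_trans)
    qed
  qed
  moreover have "cball z d \<subseteq> {z. Re z > 0}" using Re_ge d by force
  ultimately show "\<exists>d>0. cball z d \<subseteq> {z. Re z > 0} \<and>
      uniform_limit (cball z d) (\<lambda>n z. integral (cbox (- real n) (real n)) (f z))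
        (\<lambda>z. LBINT x. exp (- z * of_real (x\<^sup>2) + \<beta> * of_real x)) sequentially"
    using d unfolding f_def by blast
qed

text \<open>Both sides are holomorphic in \<open>a\<close>, and for real \<open>a\<close> the left-hand side is the characteristic
  function of a normal distribution.\<close>

lemma integral_cexp_quadratic:
  fixes a \<beta> :: complex
  assumes "Re a > 0"
  shows "(LBINT x. exp (- a * of_real (x\<^sup>2) + \<beta> * of_real x))
           = of_real (sqrt pi) / csqrt a * exp (\<beta>\<^sup>2 / (4 * a))"
proof -
  let ?S = "{z. Re z > 0}"
  let ?h = "\<lambda>a. (LBINT x::real. exp (- a * of_real (x\<^sup>2) + \<beta> * of_real x))
           - of_real (sqrt pi) / csqrt a * exp (\<beta>\<^sup>2 / (4 * a))"
  have nz: "z \<noteq> 0" "z \<notin> \<real>\<^sub>\<le>\<^sub>0" if "z \<in> ?S" for z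
    using that by (auto simp: complex_nonpos_Reals_iff)
  have "?h a = 0"
  proof (rule analytic_continuation[where f = ?h and w = a])
    show "?h holomorphic_on ?S"
      using nz by (intro holomorphic_intros holomorphic_integral_cexp_quadratic) auto
    show "open ?S" by (rule open_halfspace_Re_gt)
    show "connected ?S" by (rule convex_connected[OF convex_halfspace_Re_gt])
    show "complex_of_real ` {0<..} \<subseteq> ?S" by auto
    show "(1::complex) \<in> ?S" by simp
    show "(1::complex) islimpt complex_of_real ` {0<..}"
    proof (rule islimpt_approachable[THEN iffD2], intro allI impI)
      fix e :: real assume "e > 0"
      then show "\<exists>x'\<in>complex_of_real ` {0<..}. x' \<noteq> 1 \<and> dist x' 1 < e"
        by (intro bexI[of _ "of_real (1 + e / 2)"] imageI) (auto simp: dist_norm)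
    qed
    show "?h z = 0" if zU: "z \<in> complex_of_real ` {0<..}" for z
    proof -
      obtain x where x: "z = of_real x" "x > 0" using zU by auto
      show ?thesis unfolding x(1) integral_cexp_quadratic_real[OF x(2)] by (rule diff_self)
    qed
    show "a \<in> ?S" using assms by simp
  qed
  then show ?thesis by simp
qed

section \<open>Fourier transforms of Gaussians\<close>

text \<open>\<open>lborel\<close> on a Euclidean space is the image of a product of one-dimensional
  Lebesgue measures indexed by \<open>Basis\<close>, so integrals of tensor products factor. This is
  the passage from the line to dimension \<open>DIM('a)\<close>.\<close>

lemma
  fixes f :: "'a::euclidean_space \<Rightarrow> real \<Rightarrow> complex"
  assumes "\<And>b. b \<in> Basis \<Longrightarrow> integrable lborel (f b)"
  shows integrable_prod_Basis: "integrable lborel (\<lambda>x::'a. \<Prod>b\<in>Basis. f b (x \<bullet> b))"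
    and integral_prod_Basis:
      "(LBINT x::'a. \<Prod>b\<in>Basis. f b (x \<bullet> b)) = (\<Prod>b\<in>Basis. LBINT y. f b y)"
proof -
  interpret product_sigma_finite "\<lambda>_::'a. lborel :: real measure" ..
  have [measurable]: "f b \<in> borel_measurable borel" if "b \<in> Basis" for b
    using borel_measurable_integrable[OF assms[OF that]] by simp
  have [measurable]: "(\<lambda>x::'a. \<Prod>b\<in>Basis. f b (x \<bullet> b)) \<in> borel_measurable borel"
    by (rule borel_measurable_prod) (auto intro: measurable_compose[OF borel_measurable_inner])
  have eq: "(\<Prod>b\<in>Basis. f b ((\<Sum>b'\<in>Basis. y b' *\<^sub>R b') \<bullet> b)) = (\<Prod>b\<in>Basis. f b (y b))"
    for y :: "'a \<Rightarrow> real"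
    by (intro prod.cong) auto
  show "integrable lborel (\<lambda>x::'a. \<Prod>b\<in>Basis. f b (x \<bullet> b))"
    by (subst lborel_eq, subst integrable_distr_eq)
       (auto simp: eq intro!: product_integrable_prod assms)
  show "(LBINT x::'a. \<Prod>b\<in>Basis. f b (x \<bullet> b)) = (\<Prod>b\<in>Basis. LBINT y. f b y)"
    by (subst lborel_eq, subst integral_distr)
       (auto simp: eq intro!: product_integral_prod assms)
qed

lemma norm_power2_eq_sum_Basis: "(norm x)\<^sup>2 = (\<Sum>b\<in>Basis. (x \<bullet> b)\<^sup>2)"
  using euclidean_inner[of x x] by (simp add: power2_norm_eq_inner) (simp add: power2_eq_square)

lemma
  fixes a :: complex and w :: "'a::euclidean_space \<Rightarrow> complex"
  assumes a: "Re a > 0"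
  shows integrable_cexp_quadratic_euclidean:
      "integrable lborel (\<lambda>x::'a. exp (- a * of_real ((norm x)\<^sup>2)
         + (\<Sum>b\<in>Basis. w b * of_real (x \<bullet> b))))"
    and integral_cexp_quadratic_euclidean:
      "(LBINT x::'a. exp (- a * of_real ((norm x)\<^sup>2) + (\<Sum>b\<in>Basis. w b * of_real (x \<bullet> b))))
         = (of_real (sqrt pi) / csqrt a) ^ DIM('a) * exp ((\<Sum>b\<in>Basis. (w b)\<^sup>2) / (4 * a))"
proof -
  have eq: "exp (- a * of_real ((norm x)\<^sup>2) + (\<Sum>b\<in>Basis. w b * of_real (x \<bullet> b)))
      = (\<Prod>b\<in>Basis. exp (- a * of_real ((x \<bullet> b)\<^sup>2) + w b * of_real (x \<bullet> b)))" for x :: 'a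
  proof -
    have "- a * of_real ((norm x)\<^sup>2) + (\<Sum>b\<in>Basis. w b * of_real (x \<bullet> b))
        = (\<Sum>b\<in>Basis. - a * of_real ((x \<bullet> b)\<^sup>2) + w b * of_real (x \<bullet> b))"
      by (simp only: norm_power2_eq_sum_Basis of_real_sum sum_distrib_left sum.distrib)
    then show ?thesis
      by (simp only: exp_sum finite_Basis)
  qed
  show "integrable lborel (\<lambda>x::'a. exp (- a * of_real ((norm x)\<^sup>2)
         + (\<Sum>b\<in>Basis. w b * of_real (x \<bullet> b))))"
    unfolding eq by (intro integrable_prod_Basis integrable_cexp_quadratic a)
  show "(LBINT x::'a. exp (- a * of_real ((norm x)\<^sup>2) + (\<Sum>b\<in>Basis. w b * of_real (x \<bullet> b))))
         = (of_real (sqrt pi) / csqrt a) ^ DIM('a) * exp ((\<Sum>b\<in>Basis. (w b)\<^sup>2) / (4 * a))"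
    unfolding eq
    by (subst integral_prod_Basis[OF integrable_cexp_quadratic[OF a]])
       (simp only: integral_cexp_quadratic[OF a] prod.distrib prod_constant exp_sum[symmetric]
         finite_Basis sum_divide_distrib)
qed

text \<open>The linear term points along the diagonal \<open>\<Sum>Basis\<close>, so a single
  complex number encodes it. The class is stable under the Fourier transform, quadratic phases,
  products and the nonlinearity, hence under everything in the integrand of
  \<open>Xi1\<close>.\<close>

definition gauss :: "complex \<Rightarrow> complex \<Rightarrow> complex \<Rightarrow> 'a::euclidean_space \<Rightarrow> complex" where
  "gauss c a \<beta> x = c * exp (- a * of_real ((norm x)\<^sup>2) + \<beta> * of_real (x \<bullet> \<Sum>Basis))"

lemma gauss_eq_sum:
  "gauss c a \<beta> x = c * exp (- a * of_real ((norm x)\<^sup>2) + (\<Sum>b\<in>Basis. \<beta> * of_real (x \<bullet> b)))"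
  by (simp add: gauss_def inner_sum_right sum_distrib_left)

lemma norm_gauss:
  "norm (gauss c a \<beta> x) = norm c * exp (- Re a * (norm x)\<^sup>2 + Re \<beta> * (x \<bullet> \<Sum>Basis))"
  by (simp add: gauss_def norm_mult)

lemma integrable_gauss: "Re a > 0 \<Longrightarrow> integrable lborel (gauss c a \<beta>)"
  unfolding gauss_eq_sum
  by (intro integrable_mult_right integrable_cexp_quadratic_euclidean)

lemma integral_gauss:
  assumes "Re a > 0"
  shows "(LBINT x::'a::euclidean_space. gauss c a \<beta> x)
    = c * (of_real (sqrt pi) / csqrt a) ^ DIM('a) * exp (of_nat DIM('a) * \<beta>\<^sup>2 / (4 * a))"
  unfolding gauss_eq_sum
  by (subst integral_mult_right_zero, subst integral_cexp_quadratic_euclidean[OF assms])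
     simp

lemma gauss_mult: "gauss c a \<beta> x * gauss c' a' \<beta>' x = gauss (c * c') (a + a') (\<beta> + \<beta>') x"
  by (simp add: gauss_def algebra_simps flip: exp_add)

lemma cis_mult_gauss:
  "cis (- t * (norm x)\<^sup>2) * gauss c a \<beta> x = gauss c (a + \<i> * of_real t) \<beta> x"
  by (simp add: gauss_def cis_conv_exp algebra_simps flip: exp_add)

lemma gauss_minus: "gauss c a \<beta> (- x) = gauss c a (- \<beta>) x"
  by (simp add: gauss_def)

text \<open>The value at the origin of the Fourier transform of \<open>gauss 1 a \<beta>\<close>.
  The first factor is the principal branch of \<open>(2 * a)\<close> to the power
  \<open>- d / 2\<close>, what remains of the Gaussian integral after the unitary
  normalisation.\<close>

definition fourier_gauss_const :: "nat \<Rightarrow> complex \<Rightarrow> complex \<Rightarrow> complex" where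
  "fourier_gauss_const d a \<beta> = (1 / (of_real (sqrt 2) * csqrt a)) ^ d * exp (of_nat d * \<beta>\<^sup>2 / (4 * a))"

text \<open>The character turns the linear coefficient in direction \<open>b\<close> into
  \<open>\<beta> - \<i> * (\<xi> \<bullet> b)\<close>; the sum of the squares of these splits into a
  constant, a quadratic term in \<xi> and a linear term along the diagonal.\<close>

lemma fourier_gauss:
  assumes a: "Re a > 0"
  shows "fourier (gauss c a \<beta> :: 'a::euclidean_space \<Rightarrow> complex)
    = gauss (c * fourier_gauss_const DIM('a) a \<beta>) (1 / (4 * a)) (- \<i> * \<beta> / (2 * a))"
proof
  fix \<xi> :: 'a
  have a0: "a \<noteq> 0" using a by auto
  have "(LBINT x. cis (- (x \<bullet> \<xi>)) * gauss c a \<beta> x)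
      = (LBINT x. c * exp (- a * of_real ((norm x)\<^sup>2)
           + (\<Sum>b\<in>Basis. (\<beta> - \<i> * of_real (\<xi> \<bullet> b)) * of_real (x \<bullet> b))))"
  proof (rule Bochner_Integration.integral_cong[OF refl])
    fix x :: 'a
    have *: "(\<Sum>b\<in>Basis. (\<beta> - \<i> * of_real (\<xi> \<bullet> b)) * of_real (x \<bullet> b))
       = (\<Sum>b\<in>Basis. \<beta> * of_real (x \<bullet> b)) - \<i> * of_real (x \<bullet> \<xi>)"
      by (simp add: euclidean_inner[of x \<xi>] algebra_simps sum_subtractf sum_distrib_left)
    show "cis (- (x \<bullet> \<xi>)) * gauss c a \<beta> x = c * exp (- a * of_real ((norm x)\<^sup>2)
           + (\<Sum>b\<in>Basis. (\<beta> - \<i> * of_real (\<xi> \<bullet> b)) * of_real (x \<bullet> b)))"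
      unfolding * by (simp add: gauss_eq_sum cis_conv_exp algebra_simps flip: exp_add)
  qed
  also have "\<dots> = c * ((of_real (sqrt pi) / csqrt a) ^ DIM('a) *
        exp ((\<Sum>b\<in>Basis. (\<beta> - \<i> * of_real (\<xi> \<bullet> b))\<^sup>2) / (4 * a)))"
    by (subst integral_mult_right_zero, subst integral_cexp_quadratic_euclidean[OF a]) simp
  also have "(\<Sum>b\<in>Basis. (\<beta> - \<i> * of_real (\<xi> \<bullet> b))\<^sup>2)
      = of_nat DIM('a) * \<beta>\<^sup>2 - of_real ((norm \<xi>)\<^sup>2) - 2 * \<i> * \<beta> * of_real (\<xi> \<bullet> \<Sum>Basis)"
  proof -
    have "(\<Sum>b\<in>Basis. (\<beta> - \<i> * of_real (\<xi> \<bullet> b))\<^sup>2)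
        = (\<Sum>b\<in>Basis. \<beta>\<^sup>2 - of_real ((\<xi> \<bullet> b)\<^sup>2) - 2 * \<i> * \<beta> * of_real (\<xi> \<bullet> b))"
      by (simp add: power2_eq_square algebra_simps)
    then show ?thesis
      by (simp add: norm_power2_eq_sum_Basis[of \<xi>] sum_subtractf sum_distrib_left inner_sum_right)
  qed
  finally have int: "(LBINT x. cis (- (x \<bullet> \<xi>)) * gauss c a \<beta> x)
      = c * ((of_real (sqrt pi) / csqrt a) ^ DIM('a) *
        exp ((of_nat DIM('a) * \<beta>\<^sup>2 - of_real ((norm \<xi>)\<^sup>2) - 2 * \<i> * \<beta> * of_real (\<xi> \<bullet> \<Sum>Basis)) / (4 * a)))" .
  have 1: "(of_nat DIM('a) * \<beta>\<^sup>2 - of_real ((norm \<xi>)\<^sup>2) - 2 * \<i> * \<beta> * of_real (\<xi> \<bullet> \<Sum>Basis)) / (4 * a)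
      = of_nat DIM('a) * \<beta>\<^sup>2 / (4 * a) +
        (- (1 / (4 * a)) * of_real ((norm \<xi>)\<^sup>2) + (- \<i> * \<beta> / (2 * a)) * of_real (\<xi> \<bullet> \<Sum>Basis))"
    using a0 by (simp add: field_simps)
  have 2: "complex_of_real ((2 * pi) powr (- real DIM('a) / 2)) * (of_real (sqrt pi) / csqrt a) ^ DIM('a)
      = (1 / (of_real (sqrt 2) * csqrt a)) ^ DIM('a)"
  proof -
    have "(2 * pi) powr (- real DIM('a) / 2) = ((2 * pi) powr (- 1 / 2)) powr real DIM('a)"
      by (simp add: powr_powr)
    also have "\<dots> = (1 / sqrt (2 * pi)) ^ DIM('a)"
    proof -
      have "(2 * pi) powr (- 1 / 2) = inverse ((2 * pi) powr (1 / 2))"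
        using powr_minus[of "2 * pi" "1 / 2"] by simp
      also have "\<dots> = 1 / sqrt (2 * pi)"
        by (subst powr_half_sqrt) (auto simp: inverse_eq_divide)
      finally show ?thesis by (simp add: powr_realpow)
    qed
    finally have "complex_of_real ((2 * pi) powr (- real DIM('a) / 2)) * (of_real (sqrt pi) / csqrt a) ^ DIM('a)
      = (of_real (1 / sqrt (2 * pi)) * (of_real (sqrt pi) / csqrt a)) ^ DIM('a)"
      by (simp only: power_mult_distrib of_real_power)
    also have "of_real (1 / sqrt (2 * pi)) * (of_real (sqrt pi) / csqrt a) = 1 / (of_real (sqrt 2) * csqrt a)"
      by (simp add: real_sqrt_mult)
    finally show ?thesis .
  qed
  have "fourier (gauss c a \<beta>) \<xi>
    = c * (complex_of_real ((2 * pi) powr (- real DIM('a) / 2)) * (of_real (sqrt pi) / csqrt a) ^ DIM('a)) *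
       exp (of_nat DIM('a) * \<beta>\<^sup>2 / (4 * a) +
        (- (1 / (4 * a)) * of_real ((norm \<xi>)\<^sup>2) + (- \<i> * \<beta> / (2 * a)) * of_real (\<xi> \<bullet> \<Sum>Basis)))"
    unfolding fourier_def int 1 by (simp only: mult_ac)
  then show "fourier (gauss c a \<beta>) \<xi>
    = gauss (c * fourier_gauss_const DIM('a) a \<beta>) (1 / (4 * a)) (- \<i> * \<beta> / (2 * a)) \<xi>"
    unfolding 2 gauss_def fourier_gauss_const_def exp_add by (simp only: mult_ac)
qed

section \<open>Fourier inversion and decay for Gaussians\<close>

lemma inv_fourier_eq_fourier: "inv_fourier f x = fourier f (- x)"
  by (simp add: inv_fourier_def fourier_def inner_commute)

lemma inv_fourier_gauss:
  assumes a: "Re a > 0"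
  shows "inv_fourier (gauss c a \<beta> :: 'a::euclidean_space \<Rightarrow> complex)
    = gauss (c * fourier_gauss_const DIM('a) a \<beta>) (1 / (4 * a)) (\<i> * \<beta> / (2 * a))"
  by (rule ext) (simp add: inv_fourier_eq_fourier fourier_gauss[OF a] gauss_minus)

text \<open>Keeps the transformed rate in the right half-plane, so that Fourier transforms can be
  iterated.\<close>

lemma Re_inverse_pos:
  assumes "Re a > 0"
  shows "Re (1 / (4 * a)) > 0"
proof -
  have "Re (1 / (4 * a)) = 4 * Re a / ((4 * Re a)\<^sup>2 + (4 * Im a)\<^sup>2)"
    by (simp add: Re_divide)
  moreover have "(4 * Re a)\<^sup>2 + (4 * Im a)\<^sup>2 > 0"
    using assms by (intro add_pos_nonneg) auto
  ultimately show ?thesis using assms by simp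
qed

text \<open>Inversion by computation: the two prefactors multiply to 1 and the two constant
  exponents cancel.\<close>

lemma fourier_inv_fourier_gauss:
  assumes a: "Re a > 0"
  shows "fourier (inv_fourier (gauss c a \<beta> :: 'a::euclidean_space \<Rightarrow> complex)) = gauss c a \<beta>"
proof -
  have a0: "a \<noteq> 0" using a by auto
  \<comment> \<open>The branch must match for the prefactors to cancel: on the right half-plane the
    principal square root has positive real part, and inversion preserves this.\<close>
  have "csqrt (1 / (4 * a)) = 1 / (2 * csqrt a)"
  proof (rule csqrt_unique)
    show "(1 / (2 * csqrt a))\<^sup>2 = 1 / (4 * a)"
      by (simp add: power_divide power_mult_distrib)
    have "Re (csqrt a) > 0"
      using a by (simp add: csqrt.sel) (smt (verit) abs_Re_le_cmod real_sqrt_gt_zero)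
    then have "Re (1 / (2 * csqrt a)) > 0"
      using Re_inverse_pos[of "csqrt a / 2"] by simp
    then show "0 < Re (1 / (2 * csqrt a)) \<or> Re (1 / (2 * csqrt a)) = 0 \<and> 0 \<le> Im (1 / (2 * csqrt a))"
      by blast
  qed
  moreover have "of_real (sqrt 2) * of_real (sqrt 2) = (2 :: complex)"
    by (simp flip: of_real_mult)
  moreover have "csqrt a \<noteq> 0" using a0 by simp
  ultimately have 1: "(1 / (of_real (sqrt 2) * csqrt a)) * (1 / (of_real (sqrt 2) * csqrt (1 / (4 * a)))) = 1"
    by (simp only:) (simp add: mult.assoc[symmetric])
  have "of_nat DIM('a) * \<beta>\<^sup>2 / (4 * a) + of_nat DIM('a) * (\<i> * \<beta> / (2 * a))\<^sup>2 / (4 * (1 / (4 * a))) = 0"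
    using a0 by (simp add: power2_eq_square field_simps)
  then have "exp (of_nat DIM('a) * \<beta>\<^sup>2 / (4 * a)) *
      exp (of_nat DIM('a) * (\<i> * \<beta> / (2 * a))\<^sup>2 / (4 * (1 / (4 * a)))) = 1"
    by (simp only: exp_add[symmetric] exp_zero)
  then have "fourier_gauss_const DIM('a) a \<beta> * fourier_gauss_const DIM('a) (1 / (4 * a)) (\<i> * \<beta> / (2 * a))
     = ((1 / (of_real (sqrt 2) * csqrt a)) * (1 / (of_real (sqrt 2) * csqrt (1 / (4 * a))))) ^ DIM('a)"
    unfolding fourier_gauss_const_def power_mult_distrib by (simp only: mult_ac mult_1_right) (simp add: mult_ac)
  then have "fourier_gauss_const DIM('a) a \<beta> * fourier_gauss_const DIM('a) (1 / (4 * a)) (\<i> * \<beta> / (2 * a)) = 1"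
    unfolding 1 by simp
  then show ?thesis
    unfolding inv_fourier_gauss[OF a] fourier_gauss[OF Re_inverse_pos[OF a]] mult.assoc
    using a0 by (simp add: field_simps)
qed

text \<open>The polynomial weight is absorbed by \<open>exp (1 + n)\<close>, whose series contains
  \<open>(1 + n) ^ k / fact k\<close>; the resulting quadratic exponent is bounded by its value at
  the vertex \<open>(E + 1) / (2 * \<delta>)\<close>.\<close>

lemma gauss_decay:
  assumes "Re a > 0"
  obtains B where "\<And>x. (1 + norm x) ^ k * norm (gauss c a \<beta> x) \<le> B"
proof
  fix x :: 'a
  define n \<delta> E where "n = norm x" and "\<delta> = Re a" and "E = \<bar>Re \<beta>\<bar> * norm (\<Sum>Basis :: 'a)"
  have \<delta>: "\<delta> > 0" using assms by (simp add: \<delta>_def)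
  have pow: "(1 + n) ^ k \<le> fact k * exp (1 + n)"
  proof -
    have "(1 + n) ^ k / fact k \<le> exp (1 + n)"
    proof -
      have "(\<Sum>i\<in>{k}. (1 + n) ^ i /\<^sub>R fact i) \<le> (\<Sum>i. (1 + n) ^ i /\<^sub>R fact i)"
        by (rule sum_le_suminf[OF summable_exp_generic]) (auto simp: n_def)
      then show ?thesis by (simp add: exp_def field_simps)
    qed
    then show ?thesis by (simp add: field_simps)
  qed
  have "Re \<beta> * (x \<bullet> \<Sum>Basis) \<le> \<bar>Re \<beta>\<bar> * \<bar>x \<bullet> \<Sum>Basis\<bar>"
    by (metis abs_ge_self abs_mult)
  also have "\<dots> \<le> \<bar>Re \<beta>\<bar> * (norm x * norm (\<Sum>Basis :: 'a))"
    by (intro mult_left_mono Cauchy_Schwarz_ineq2) auto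
  finally have "norm (gauss c a \<beta> x) \<le> norm c * exp (- \<delta> * n\<^sup>2 + E * n)"
    unfolding norm_gauss n_def E_def \<delta>_def by (intro mult_left_mono) (auto simp: algebra_simps)
  then have "(1 + norm x) ^ k * norm (gauss c a \<beta> x)
      \<le> (fact k * exp (1 + n)) * (norm c * exp (- \<delta> * n\<^sup>2 + E * n))"
    using pow by (intro mult_mono) (auto simp: n_def)
  also have "\<dots> = fact k * norm c * exp (1 + n + (- \<delta> * n\<^sup>2 + E * n))"
    by (simp add: exp_add)
  also have "\<dots> \<le> fact k * norm c * exp (1 + (E + 1)\<^sup>2 / (4 * \<delta>))"
  proof -
    have "0 \<le> \<delta> * (n - (E + 1) / (2 * \<delta>))\<^sup>2" using \<delta> by simp
    also have "\<dots> = \<delta> * n\<^sup>2 - (E + 1) * n + (E + 1)\<^sup>2 / (4 * \<delta>)"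
      using \<delta> by (simp add: power2_eq_square field_simps)
    finally show ?thesis by (intro mult_left_mono) (auto simp: algebra_simps)
  qed
  finally show "(1 + norm x) ^ k * norm (gauss c a \<beta> x)
      \<le> fact k * norm c * exp (1 + (\<bar>Re \<beta>\<bar> * norm (\<Sum>Basis :: 'a) + 1)\<^sup>2 / (4 * Re a))"
    unfolding E_def \<delta>_def .
qed

section \<open>Families of Gaussians\<close>

text \<open>Continuity of the parameters in \<open>r\<close> gives joint measurability and, for \<open>r\<close> in a compact set,
  a common integrable majorant; this justifies every exchange of integrals below.\<close>

definition gauss_family :: "(real \<Rightarrow> 'a::euclidean_space \<Rightarrow> complex) \<Rightarrow> bool" where
  "gauss_family F \<longleftrightarrow> (\<exists>c a \<beta>. continuous_on UNIV c \<and> continuous_on UNIV a \<and> continuous_on UNIV \<beta> \<and>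
     (\<forall>r. Re (a r) > 0) \<and> F = (\<lambda>r. gauss (c r) (a r) (\<beta> r)))"

lemma gauss_familyI:
  "continuous_on UNIV c \<Longrightarrow> continuous_on UNIV a \<Longrightarrow> continuous_on UNIV \<beta> \<Longrightarrow> (\<And>r. Re (a r) > 0)
    \<Longrightarrow> (\<And>r. F r = gauss (c r) (a r) (\<beta> r)) \<Longrightarrow> gauss_family F"
  unfolding gauss_family_def by blast

lemma gauss_familyE:
  assumes "gauss_family F"
  obtains c a \<beta> where "continuous_on UNIV c" "continuous_on UNIV a" "continuous_on UNIV \<beta>"
    "\<And>r. Re (a r) > 0" "\<And>r. F r = gauss (c r) (a r) (\<beta> r)"
  using assms unfolding gauss_family_def by blast

lemma gauss_family_const: "Re a > 0 \<Longrightarrow> gauss_family (\<lambda>_. gauss c a \<beta>)"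
  by (rule gauss_familyI[of "\<lambda>_. c" "\<lambda>_. a" "\<lambda>_. \<beta>"]) auto

lemma gauss_family_cis:
  assumes "gauss_family F" "continuous_on UNIV \<theta>"
  shows "gauss_family (\<lambda>r x. cis (- \<theta> r * (norm x)\<^sup>2) * F r x)"
proof -
  from assms(1) obtain c a \<beta> where *: "continuous_on UNIV c" "continuous_on UNIV a"
    "continuous_on UNIV \<beta>" "\<And>r. Re (a r) > 0" "\<And>r. F r = gauss (c r) (a r) (\<beta> r)"
    by (elim gauss_familyE) blast
  show ?thesis
  proof (rule gauss_familyI)
    show "(\<lambda>x. cis (- \<theta> r * (norm x)\<^sup>2) * F r x) = gauss (c r) (a r + \<i> * of_real (\<theta> r)) (\<beta> r)"
      for r unfolding *(5) by (intro ext cis_mult_gauss)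
  qed (use *(4) assms(2) in \<open>auto intro!: continuous_intros *\<close>)
qed

lemma continuous_on_fourier_gauss_const:
  assumes "continuous_on UNIV a" "continuous_on UNIV \<beta>" "\<And>r. Re (a r) > 0"
  shows "continuous_on UNIV (\<lambda>r. fourier_gauss_const d (a r) (\<beta> r))"
proof -
  have "a r \<noteq> 0" "a r \<notin> \<real>\<^sub>\<le>\<^sub>0" for r
    using assms(3)[of r] by (auto simp: complex_nonpos_Reals_iff)
  then show ?thesis
    unfolding fourier_gauss_const_def using assms(1,2)
    by (intro continuous_intros continuous_on_compose2[OF continuous_on_csqrt, of _ a]) auto
qed

lemma gauss_family_fourier:
  assumes "gauss_family (F :: real \<Rightarrow> 'a::euclidean_space \<Rightarrow> complex)"
  shows "gauss_family (\<lambda>r. fourier (F r))"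
proof -
  from assms(1) obtain c a \<beta> where *: "continuous_on UNIV c" "continuous_on UNIV a"
    "continuous_on UNIV \<beta>" "\<And>r. Re (a r) > 0" "\<And>r. F r = gauss (c r) (a r) (\<beta> r)"
    by (elim gauss_familyE) blast
  have "a r \<noteq> 0" for r
    using *(4)[of r] by auto
  then show ?thesis
    using * by (intro gauss_familyI[of "\<lambda>r. c r * fourier_gauss_const DIM('a) (a r) (\<beta> r)"
        "\<lambda>r. 1 / (4 * a r)" "\<lambda>r. - \<i> * \<beta> r / (2 * a r)"] Re_inverse_pos)
      (auto intro!: continuous_intros continuous_on_fourier_gauss_const simp: fourier_gauss)
qed

lemma gauss_family_inv_fourier:
  assumes "gauss_family (F :: real \<Rightarrow> 'a::euclidean_space \<Rightarrow> complex)"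
  shows "gauss_family (\<lambda>r. inv_fourier (F r))"
proof -
  from assms(1) obtain c a \<beta> where *: "continuous_on UNIV c" "continuous_on UNIV a"
    "continuous_on UNIV \<beta>" "\<And>r. Re (a r) > 0" "\<And>r. F r = gauss (c r) (a r) (\<beta> r)"
    by (elim gauss_familyE) blast
  have "a r \<noteq> 0" for r
    using *(4)[of r] by auto
  then show ?thesis
    using * by (intro gauss_familyI[of "\<lambda>r. c r * fourier_gauss_const DIM('a) (a r) (\<beta> r)"
        "\<lambda>r. 1 / (4 * a r)" "\<lambda>r. \<i> * \<beta> r / (2 * a r)"] Re_inverse_pos)
      (auto intro!: continuous_intros continuous_on_fourier_gauss_const simp: inv_fourier_gauss)
qed

lemma gauss_family_schroedinger:
  assumes "gauss_family (F :: real \<Rightarrow> 'a::euclidean_space \<Rightarrow> complex)" "continuous_on UNIV \<theta>"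
  shows "gauss_family (\<lambda>r. schroedinger (\<theta> r) (F r))"
  unfolding schroedinger_def
  by (intro gauss_family_inv_fourier gauss_family_cis gauss_family_fourier assms)

text \<open>The modulus of a Gaussian is a Gaussian whose parameters are the real parts, so its
  \<open>p\<close>-th power and the product with the original stay in the class.\<close>

lemma power_nonlinearity_gauss:
  "power_nonlinearity p (gauss c a \<beta>)
     = gauss (of_real (norm c ^ p) * c) (of_real (real p * Re a) + a) (of_real (real p * Re \<beta>) + \<beta>)"
proof
  fix x
  have "norm (gauss c a \<beta> x) ^ p
      = norm c ^ p * exp (real p * (- Re a * (norm x)\<^sup>2 + Re \<beta> * (x \<bullet> \<Sum>Basis)))"
    by (simp only: norm_gauss power_mult_distrib exp_of_nat_mult)
  then have "complex_of_real (norm (gauss c a \<beta> x) ^ p) =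
      gauss (of_real (norm c ^ p)) (of_real (real p * Re a)) (of_real (real p * Re \<beta>)) x"
    by (simp add: gauss_def exp_of_real algebra_simps flip: of_real_mult of_real_diff of_real_add of_real_power)
  then show "power_nonlinearity p (gauss c a \<beta>) x
     = gauss (of_real (norm c ^ p) * c) (of_real (real p * Re a) + a) (of_real (real p * Re \<beta>) + \<beta>) x"
    by (simp only: power_nonlinearity_def gauss_mult)
qed

lemma gauss_family_power_nonlinearity:
  assumes "gauss_family F"
  shows "gauss_family (\<lambda>r. power_nonlinearity p (F r))"
proof -
  from assms(1) obtain c a \<beta> where *: "continuous_on UNIV c" "continuous_on UNIV a"
    "continuous_on UNIV \<beta>" "\<And>r. Re (a r) > 0" "\<And>r. F r = gauss (c r) (a r) (\<beta> r)"
    by (elim gauss_familyE) blast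
  show ?thesis
  proof (rule gauss_familyI)
    show "power_nonlinearity p (F r) = gauss (of_real (norm (c r) ^ p) * c r)
       (of_real (real p * Re (a r)) + a r) (of_real (real p * Re (\<beta> r)) + \<beta> r)" for r
      unfolding *(5) by (rule power_nonlinearity_gauss)
    show "Re (of_real (real p * Re (a r)) + a r) > 0" for r
      using *(4)[of r] by (simp add: add_nonneg_pos)
  qed (intro continuous_intros *)+
qed

lemma integrable_gauss_family: "gauss_family F \<Longrightarrow> integrable lborel (F r)"
  by (elim gauss_familyE) (simp add: integrable_gauss)

lemma fourier_inv_fourier_gauss_family:
  "gauss_family F \<Longrightarrow> fourier (inv_fourier (F r)) = F r"
  by (elim gauss_familyE) (simp add: fourier_inv_fourier_gauss)

lemma continuous_gauss_family:
  assumes "gauss_family F"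
  shows "continuous_on UNIV (\<lambda>z. F (fst z) (snd z))"
proof -
  from assms(1) obtain c a \<beta> where *: "continuous_on UNIV c" "continuous_on UNIV a"
    "continuous_on UNIV \<beta>" "\<And>r. Re (a r) > 0" "\<And>r. F r = gauss (c r) (a r) (\<beta> r)"
    by (elim gauss_familyE) blast
  note [continuous_intros] = continuous_on_compose2[OF *(1)] continuous_on_compose2[OF *(2)]
    continuous_on_compose2[OF *(3)]
  show ?thesis unfolding *(5) gauss_def by (intro continuous_intros) auto
qed

lemma measurable_gauss_family:
  assumes "gauss_family F"
  shows "(\<lambda>z. F (fst z) (snd z)) \<in> borel_measurable (borel \<Otimes>\<^sub>M borel)"
  unfolding borel_prod
  by (intro borel_measurable_continuous_onI continuous_gauss_family assms)

lemma gauss_family_dominated: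
  assumes "gauss_family F" "compact K"
  obtains g where "integrable lborel g" "\<And>r x. r \<in> K \<Longrightarrow> norm (F r x) \<le> g x" "\<And>x. g x \<ge> (0::real)"
proof -
  from assms(1) obtain c a \<beta> where *: "continuous_on UNIV c" "continuous_on UNIV a"
    "continuous_on UNIV \<beta>" "\<And>r. Re (a r) > 0" "\<And>r. F r = gauss (c r) (a r) (\<beta> r)"
    by (elim gauss_familyE) blast
  have bdd: "\<exists>B. \<forall>r\<in>K. norm (f r) \<le> B" if "continuous_on UNIV f" for f :: "real \<Rightarrow> complex"
    using compact_imp_bounded[OF compact_continuous_image[OF continuous_on_subset[OF that] assms(2)]]
    by (auto simp: bounded_iff)
  obtain C where C: "\<And>r. r \<in> K \<Longrightarrow> norm (c r) \<le> C" using bdd[OF *(1)] by blast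
  obtain B where B: "\<And>r. r \<in> K \<Longrightarrow> norm (\<beta> r) \<le> B" using bdd[OF *(3)] by blast
  obtain \<delta> where \<delta>: "\<delta> > 0" "\<And>r. r \<in> K \<Longrightarrow> Re (a r) \<ge> \<delta>"
  proof (cases "K = {}")
    case False
    have "continuous_on K (\<lambda>r. Re (a r))"
      by (intro continuous_intros continuous_on_subset[OF *(2)]) auto
    from continuous_attains_inf[OF assms(2) False this] show ?thesis
      using *(4) that by blast
  qed (use that[of 1] in auto)
  \<comment> \<open>Two Gaussians with opposite linear terms, since
    \<open>exp (B * \<bar>y\<bar>)\<close> is at most \<open>exp (B * y) + exp (- B * y)\<close>.
    The absolute value of \<open>C\<close> covers an empty \<open>K\<close>, where \<open>C\<close>
    may be negative.\<close>
  define g where "g = (\<lambda>x::'a. norm (gauss (of_real \<bar>C\<bar>) (of_real \<delta>) (of_real B) x) +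
                                norm (gauss (of_real \<bar>C\<bar>) (of_real \<delta>) (of_real (- B)) x))"
  show ?thesis
  proof
    show "integrable lborel g"
      unfolding g_def using \<delta>(1)
      by (intro Bochner_Integration.integrable_add integrable_norm integrable_gauss) auto
    fix x show "g x \<ge> 0" by (simp add: g_def)
    fix r assume r: "r \<in> K"
    define y where "y = x \<bullet> \<Sum>Basis"
    have "Re (\<beta> r) * y \<le> \<bar>Re (\<beta> r)\<bar> * \<bar>y\<bar>" by (simp flip: abs_mult)
    also have "\<dots> \<le> B * \<bar>y\<bar>"
      using abs_Re_le_cmod[of "\<beta> r"] B[OF r] by (intro mult_right_mono) auto
    finally have "exp (- Re (a r) * (norm x)\<^sup>2 + Re (\<beta> r) * y) \<le> exp (- \<delta> * (norm x)\<^sup>2 + B * \<bar>y\<bar>)"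
      using mult_right_mono[OF \<delta>(2)[OF r], of "(norm x)\<^sup>2"] by simp
    also have "\<dots> \<le> exp (- \<delta> * (norm x)\<^sup>2 + B * y) + exp (- \<delta> * (norm x)\<^sup>2 + (- B) * y)"
      by (cases "y \<ge> 0") auto
    finally have "norm (c r) * exp (- Re (a r) * (norm x)\<^sup>2 + Re (\<beta> r) * y)
        \<le> \<bar>C\<bar> * (exp (- \<delta> * (norm x)\<^sup>2 + B * y) + exp (- \<delta> * (norm x)\<^sup>2 + (- B) * y))"
      using C[OF r] by (intro mult_mono) auto
    then show "norm (F r x) \<le> g x"
      unfolding g_def *(5) norm_gauss y_def by (simp add: distrib_left)
  qed
qed

text \<open>The majorant over \<open>K\<close> bounds the integrals of the slices uniformly for
  \<nu>-almost every \<open>r\<close>, and \<nu> is finite. The function \<open>\<Phi>\<close> is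
  kept general to admit extra bounded factors such as characters or a second Gaussian.\<close>

lemma integrable_pair_gauss_family:
  fixes F :: "real \<Rightarrow> 'a::euclidean_space \<Rightarrow> complex"
  assumes F: "gauss_family F" and K: "compact K"
    and \<nu>: "finite_measure \<nu>" "sets \<nu> = sets borel" "AE r in \<nu>. r \<in> K"
    and \<Phi> [measurable]: "\<Phi> \<in> borel_measurable (borel \<Otimes>\<^sub>M borel)"
    and bound: "\<And>r x. norm (\<Phi> (r, x) :: complex) \<le> B * norm (F r x)"
  shows "integrable (\<nu> \<Otimes>\<^sub>M lborel) \<Phi>"
proof -
  interpret finite_measure \<nu> by fact
  interpret pair_sigma_finite \<nu> "lborel :: 'a measure" ..
  note [measurable_cong] = \<nu>(2)
  obtain g where g: "integrable lborel g" "\<And>r x. r \<in> K \<Longrightarrow> norm (F r x) \<le> g x" "\<And>x. g x \<ge> 0"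
    using gauss_family_dominated[OF F K] by blast
  show ?thesis
  proof (rule Fubini_integrable)
    have slice: "integrable lborel (\<lambda>x. \<Phi> (r, x))" for r
      by (rule Bochner_Integration.integrable_bound[OF integrable_mult_right[OF
            integrable_norm[OF integrable_gauss_family[OF F]]], of _ B r])
         (auto intro!: AE_I2 order_trans[OF bound] simp: abs_mult mult_right_mono)
    then show "AE r in \<nu>. integrable lborel (\<lambda>x. \<Phi> (r, x))" by simp
    show "integrable \<nu> (\<lambda>r. LBINT x. norm (\<Phi> (r, x)))"
    proof (rule integrable_const_bound)
      show "AE r in \<nu>. norm (LBINT x. norm (\<Phi> (r, x))) \<le> \<bar>B\<bar> * (LBINT x. g x)"
        using \<nu>(3)
      proof eventually_elim
        case (elim r)
        have "(LBINT x. norm (\<Phi> (r, x))) \<le> (LBINT x. \<bar>B\<bar> * g x)"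
        proof (rule integral_mono)
          show "norm (\<Phi> (r, x)) \<le> \<bar>B\<bar> * g x" for x
            by (rule order_trans[OF bound]) (intro mult_mono g elim; simp add: g)
        qed (use slice g in auto)
        then show ?case by simp
      qed
    qed measurable
  qed measurable
qed

section \<open>Fourier transforms of averages, and the Parseval formula\<close>

lemma fourier_cmult: "fourier (\<lambda>x. k * f x) \<xi> = k * fourier f \<xi>"
  by (simp add: fourier_def mult.left_commute[of _ k])

lemma fourier_average:
  fixes F :: "real \<Rightarrow> 'a::euclidean_space \<Rightarrow> complex"
  assumes F: "gauss_family F" and K: "compact K"
    and \<nu>: "finite_measure \<nu>" "sets \<nu> = sets borel" "AE r in \<nu>. r \<in> K"
  shows "fourier (\<lambda>x. \<integral>r. F r x \<partial>\<nu>) \<xi> = (\<integral>r. fourier (F r) \<xi> \<partial>\<nu>)"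
proof -
  interpret finite_measure \<nu> by fact
  interpret pair_sigma_finite \<nu> "lborel :: 'a measure" ..
  note [measurable] = measurable_gauss_family[OF F]
  have int: "integrable (\<nu> \<Otimes>\<^sub>M lborel) (\<lambda>(r, x). cis (- (x \<bullet> \<xi>)) * F r x)"
    by (rule integrable_pair_gauss_family[OF F K \<nu>, where B = 1])
       (auto simp: norm_mult case_prod_unfold cis_conv_exp)
  have "(LBINT x. cis (- (x \<bullet> \<xi>)) * (\<integral>r. F r x \<partial>\<nu>)) = (LBINT x. (\<integral>r. cis (- (x \<bullet> \<xi>)) * F r x \<partial>\<nu>))"
    by simp
  also have "\<dots> = (\<integral>r. (LBINT x. cis (- (x \<bullet> \<xi>)) * F r x) \<partial>\<nu>)"
    by (rule Fubini_integral[OF int])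
  finally show ?thesis by (simp add: fourier_def)
qed

text \<open>Fubini for the kernel \<open>cis (- (x \<bullet> \<xi>)) * f x * cnj (h \<xi>)\<close>,
  which is integrable on the product space because its modulus is a tensor product; conjugation
  turns the forward kernel into the inverse one.\<close>

lemma parseval_fourier:
  fixes f h :: "'a::euclidean_space \<Rightarrow> complex"
  assumes "integrable lborel f" "integrable lborel h"
  shows "(LBINT \<xi>. fourier f \<xi> * cnj (h \<xi>)) = (LBINT x. f x * cnj (inv_fourier h x))"
proof -
  define k where "k = complex_of_real ((2 * pi) powr (- real DIM('a) / 2))"
  have [measurable]: "f \<in> borel_measurable borel" "h \<in> borel_measurable borel"
    using assms by auto
  have [measurable]: "cnj \<in> borel_measurable borel"
    by (intro borel_measurable_continuous_onI continuous_intros)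
  have m: "(\<lambda>(x, \<xi>). cis (- (x \<bullet> \<xi>)) * f x * cnj (h \<xi>)) \<in> borel_measurable (lborel \<Otimes>\<^sub>M lborel)"
    unfolding cis_conv_exp cnj.simps by measurable
  have int: "integrable (lborel \<Otimes>\<^sub>M lborel) (\<lambda>(x, \<xi>). cis (- (x \<bullet> \<xi>)) * f x * cnj (h \<xi>))"
  proof (rule lborel_pair.Fubini_integrable[OF m])
    have "integrable lborel (\<lambda>\<xi>. cis (- (x \<bullet> \<xi>)) * f x * cnj (h \<xi>))" for x
    proof (rule Bochner_Integration.integrable_bound)
      show "integrable lborel (\<lambda>\<xi>. norm (f x) * norm (h \<xi>))"
        using assms by auto
      show "(\<lambda>\<xi>. cis (- (x \<bullet> \<xi>)) * f x * cnj (h \<xi>)) \<in> borel_measurable lborel"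
        unfolding cis_conv_exp by measurable
    qed (auto simp: norm_mult)
    then show "AE x in lborel. integrable lborel
        (\<lambda>\<xi>. case (x, \<xi>) of (x, \<xi>) \<Rightarrow> cis (- (x \<bullet> \<xi>)) * f x * cnj (h \<xi>))" by simp
  qed (use assms in \<open>auto simp: norm_mult\<close>)
  have "(LBINT \<xi>. fourier f \<xi> * cnj (h \<xi>))
      = (LBINT \<xi>. k * (LBINT x. cis (- (x \<bullet> \<xi>)) * f x * cnj (h \<xi>)))"
    unfolding fourier_def k_def[symmetric] integral_mult_left_zero by (simp only: mult.assoc)
  also have "\<dots> = k * (LBINT \<xi>. (LBINT x. cis (- (x \<bullet> \<xi>)) * f x * cnj (h \<xi>)))"
    by (rule integral_mult_right_zero)
  also have "(LBINT \<xi>. (LBINT x. cis (- (x \<bullet> \<xi>)) * f x * cnj (h \<xi>)))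
     = (LBINT x. (LBINT \<xi>. cis (- (x \<bullet> \<xi>)) * f x * cnj (h \<xi>)))"
    by (rule lborel_pair.Fubini_integral[OF int])
  also have "k * \<dots> = (LBINT x. f x * (k * (LBINT \<xi>. cnj (cis (x \<bullet> \<xi>) * h \<xi>))))"
    by (simp add: cis_cnj mult_ac)
  also have "\<dots> = (LBINT x. f x * cnj (inv_fourier h x))"
  proof (rule Bochner_Integration.integral_cong[OF refl])
    fix x
    have "(LBINT \<xi>. cnj (cis (x \<bullet> \<xi>) * h \<xi>)) = cnj (LBINT \<xi>. cis (x \<bullet> \<xi>) * h \<xi>)"
      by (rule Bochner_Integration.integral_cnj)
    then show "f x * (k * (LBINT \<xi>. cnj (cis (x \<bullet> \<xi>) * h \<xi>))) = f x * cnj (inv_fourier h x)"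
      by (simp only: inv_fourier_def k_def complex_cnj_mult complex_cnj_complex_of_real)
  qed
  finally show ?thesis .
qed

section \<open>The pairing identity\<close>

text \<open>The integrand of \<^const>\<open>Xi1\<close> depends on \<open>(\<tau>, \<sigma>)\<close> only through the phase
  \<open>\<gamma> \<tau> + \<sigma>\<close>, so the double time integral is an integral over the distribution of this phase.\<close>

definition phase_measure :: "real \<Rightarrow> real \<Rightarrow> real measure" where
  "phase_measure \<gamma> t = distr (restrict_space lborel {min 0 t<..<max 0 t} \<Otimes>\<^sub>M restrict_space lborel {0<..<1})
     borel (\<lambda>(\<tau>, \<sigma>). \<gamma> * \<tau> + \<sigma>)"

lemma finite_measure_restrict_Ioo: "finite_measure (restrict_space lborel {a<..<b::real})"
  by (rule finite_measureI) (cases "a \<le> b"; simp add: emeasure_restrict_space space_restrict_space)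

lemma space_phase_domain:
  "space (restrict_space lborel {min 0 t<..<max 0 t} \<Otimes>\<^sub>M restrict_space lborel {0<..<1::real})
    = {min 0 t<..<max 0 t} \<times> {0<..<1}"
  by (simp add: space_pair_measure space_restrict_space)

lemma measurable_phase:
  "(\<lambda>(\<tau>, \<sigma>). \<gamma> * \<tau> + \<sigma>) \<in> restrict_space lborel {min 0 t<..<max 0 t} \<Otimes>\<^sub>M
      restrict_space lborel {0<..<1::real} \<rightarrow>\<^sub>M (borel :: real measure)"
proof -
  have [measurable]: "(\<lambda>x. x) \<in> restrict_space lborel A \<rightarrow>\<^sub>M (borel :: real measure)" for A
    by (rule measurable_restrict_space1) simp
  show ?thesis by measurable
qed

lemma finite_measure_phase_measure: "finite_measure (phase_measure \<gamma> t)"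
  unfolding phase_measure_def
  by (intro finite_measure.finite_measure_distr finite_measure_pair_measure
      finite_measure_restrict_Ioo measurable_phase)

lemma sets_phase_measure [simp, measurable_cong]: "sets (phase_measure \<gamma> t) = sets borel"
  by (simp add: phase_measure_def)

lemma phase_bound:
  fixes \<gamma> \<tau> \<sigma> t :: real
  assumes "\<tau> \<in> {min 0 t<..<max 0 t}" "\<sigma> \<in> {0<..<1}"
  shows "\<bar>\<gamma> * \<tau> + \<sigma>\<bar> \<le> \<bar>\<gamma>\<bar> * \<bar>t\<bar> + 1"
proof -
  have "\<bar>\<gamma> * \<tau>\<bar> \<le> \<bar>\<gamma>\<bar> * \<bar>t\<bar>"
    unfolding abs_mult by (rule mult_left_mono) (use assms in auto)
  then show ?thesis using assms(2) by auto
qed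

text \<open>Provides the compact parameter set on which Gaussian families have a common
  majorant.\<close>

lemma AE_phase_measure:
  "AE r in phase_measure \<gamma> t. r \<in> {- (\<bar>\<gamma>\<bar> * \<bar>t\<bar> + 1)..\<bar>\<gamma>\<bar> * \<bar>t\<bar> + 1}"
  unfolding phase_measure_def
proof (subst AE_distr_iff[OF measurable_phase])
  show "AE z in restrict_space lborel {min 0 t<..<max 0 t} \<Otimes>\<^sub>M restrict_space lborel {0<..<1::real}.
      (case z of (\<tau>, \<sigma>) \<Rightarrow> \<gamma> * \<tau> + \<sigma>) \<in> {- (\<bar>\<gamma>\<bar> * \<bar>t\<bar> + 1)..\<bar>\<gamma>\<bar> * \<bar>t\<bar> + 1}"
    by (rule AE_I2) (auto simp: space_phase_domain abs_le_iff dest: phase_bound[of _ t _ \<gamma>])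
qed auto

text \<open>The factor \<open>sgn t\<close> carries the orientation for negative \<open>t\<close>;
  at \<open>t = 0\<close> both sides vanish.\<close>

lemma interval_integral_zero_eq_restrict:
  fixes f :: "real \<Rightarrow> complex"
  shows "(LBINT \<tau>=0..t. f \<tau>) = of_real (sgn t) * (\<integral>\<tau>. f \<tau> \<partial>restrict_space lborel {min 0 t<..<max 0 t})"
proof -
  have e: "einterval (ereal a) (ereal b) = {a<..<b}" for a b
    by (auto simp: einterval_def)
  show ?thesis
    unfolding interval_lebesgue_integral_def zero_ereal_def e set_lebesgue_integral_def
    by (subst integral_restrict_space)
       (auto simp: sgn_if min_def max_def)
qed

text \<open>Fubini followed by transport along the phase map; \<open>h\<close> is bounded on the
  compact interval that contains all phases, hence integrable for a finite measure.\<close>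

lemma iterated_time_integral_eq_phase_measure:
  fixes h :: "real \<Rightarrow> complex"
  assumes h: "continuous_on UNIV h"
  shows "(LBINT \<tau>=0..t. (LBINT \<sigma>=0..1. h (\<gamma> * \<tau> + \<sigma>)))
    = of_real (sgn t) * (\<integral>r. h r \<partial>phase_measure \<gamma> t)"
proof -
  define M1 where "M1 = restrict_space lborel {min 0 t<..<max 0 t}"
  define M2 where "M2 = restrict_space lborel {0<..<1::real}"
  interpret M1: finite_measure M1 unfolding M1_def by (rule finite_measure_restrict_Ioo)
  interpret M2: finite_measure M2 unfolding M2_def by (rule finite_measure_restrict_Ioo)
  interpret pair_sigma_finite M1 M2 ..
  have [measurable]: "h \<in> borel_measurable borel" by (rule borel_measurable_continuous_onI[OF h])
  have ph [measurable]: "(\<lambda>(\<tau>, \<sigma>). \<gamma> * \<tau> + \<sigma>) \<in> M1 \<Otimes>\<^sub>M M2 \<rightarrow>\<^sub>M borel"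
    unfolding M1_def M2_def by (rule measurable_phase)
  have hm [measurable]: "(\<lambda>(\<tau>, \<sigma>). h (\<gamma> * \<tau> + \<sigma>)) \<in> borel_measurable (M1 \<Otimes>\<^sub>M M2)"
    using measurable_compose[OF ph, of h borel] by (simp add: case_prod_unfold)
  define R where "R = \<bar>\<gamma>\<bar> * \<bar>t\<bar> + 1"
  obtain B where B: "\<And>r. r \<in> {- R..R} \<Longrightarrow> norm (h r) \<le> B"
    using compact_imp_bounded[OF compact_continuous_image[OF continuous_on_subset[OF h] compact_Icc]]
    by (force simp: bounded_iff)
  interpret M12: finite_measure "M1 \<Otimes>\<^sub>M M2"
    by (intro finite_measure_pair_measure) unfold_locales
  have "(LBINT \<tau>=0..t. (LBINT \<sigma>=0..1. h (\<gamma> * \<tau> + \<sigma>)))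
      = of_real (sgn t) * (\<integral>\<tau>. (\<integral>\<sigma>. h (\<gamma> * \<tau> + \<sigma>) \<partial>M2) \<partial>M1)"
    unfolding one_ereal_def interval_integral_zero_eq_restrict M1_def M2_def by simp
  also have "(\<integral>\<tau>. (\<integral>\<sigma>. h (\<gamma> * \<tau> + \<sigma>) \<partial>M2) \<partial>M1) = (\<integral>z. h (case z of (\<tau>, \<sigma>) \<Rightarrow> \<gamma> * \<tau> + \<sigma>) \<partial>(M1 \<Otimes>\<^sub>M M2))"
  proof (subst integral_fst)
    show "integrable (M1 \<Otimes>\<^sub>M M2) (\<lambda>(\<tau>, \<sigma>). h (\<gamma> * \<tau> + \<sigma>))"
    proof (rule M12.integrable_const_bound)
      show "AE z in M1 \<Otimes>\<^sub>M M2. norm (case z of (\<tau>, \<sigma>) \<Rightarrow> h (\<gamma> * \<tau> + \<sigma>)) \<le> B"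
        by (rule AE_I2)
           (auto simp: M1_def M2_def space_phase_domain R_def abs_le_iff intro!: B dest: phase_bound[of _ t _ \<gamma>])
    qed measurable
  qed (simp add: case_prod_unfold)
  also have "\<dots> = (\<integral>r. h r \<partial>phase_measure \<gamma> t)"
    unfolding phase_measure_def M1_def[symmetric] M2_def[symmetric]
    by (subst integral_distr) auto
  finally show ?thesis .
qed

text \<open>With \<open>r = \<gamma> * \<tau> + \<sigma>\<close> the outer propagator time
  \<open>\<gamma> * (t - \<tau>) - \<sigma>\<close> is \<open>\<gamma> * t - r\<close>.\<close>

lemma Xi1_gauss_eq:
  fixes \<phi> :: "'a::euclidean_space \<Rightarrow> complex"
  assumes "gauss_family (\<lambda>_::real. \<phi>)"
  shows "Xi1 \<gamma> p \<phi> t = (\<lambda>x. \<i> * of_real (sgn t) *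
     (\<integral>r. schroedinger (\<gamma> * t - r) (power_nonlinearity p (schroedinger r \<phi>)) x \<partial>phase_measure \<gamma> t))"
proof
  fix x
  define h where "h = (\<lambda>r. schroedinger (\<gamma> * t - r) (power_nonlinearity p (schroedinger r \<phi>)) x)"
  have "gauss_family (\<lambda>r. schroedinger (\<gamma> * t - r) (power_nonlinearity p (schroedinger r \<phi>)))"
    by (intro gauss_family_schroedinger gauss_family_power_nonlinearity assms continuous_intros)
  moreover have "continuous_on UNIV (\<lambda>r::real. (r, x))" by (intro continuous_intros)
  ultimately have "continuous_on UNIV h"
    using continuous_on_compose2[OF continuous_gauss_family]
    by (force simp: h_def)
  from iterated_time_integral_eq_phase_measure[OF this, where t = t and \<gamma> = \<gamma>]
  show "Xi1 \<gamma> p \<phi> t x = \<i> * of_real (sgn t) *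
     (\<integral>r. schroedinger (\<gamma> * t - r) (power_nonlinearity p (schroedinger r \<phi>)) x \<partial>phase_measure \<gamma> t)"
    by (simp add: Xi1_def h_def algebra_simps)
qed

section \<open>The frequency side of \<open>Xi1\<close> on Gaussian data\<close>

lemma fourier_schroedinger_gauss_family:
  assumes "gauss_family F"
  shows "fourier (schroedinger t (F r)) \<xi> = cis (- t * (norm \<xi>)\<^sup>2) * fourier (F r) \<xi>"
proof -
  have "gauss_family (\<lambda>r \<xi>. cis (- t * (norm \<xi>)\<^sup>2) * fourier (F r) \<xi>)"
    by (intro gauss_family_cis gauss_family_fourier assms continuous_intros)
  from fourier_inv_fourier_gauss_family[OF this, of r] show ?thesis
    by (simp add: schroedinger_def)
qed

lemma fourier_Xi1_gauss:
  fixes \<phi> :: "'a::euclidean_space \<Rightarrow> complex"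
  assumes "gauss_family (\<lambda>_::real. \<phi>)"
  shows "fourier (Xi1 \<gamma> p \<phi> t) \<xi> = \<i> * of_real (sgn t) *
     (\<integral>r. cis (- (\<gamma> * t - r) * (norm \<xi>)\<^sup>2) * fourier (power_nonlinearity p (schroedinger r \<phi>)) \<xi>
        \<partial>phase_measure \<gamma> t)"
proof -
  have 1: "gauss_family (\<lambda>r. power_nonlinearity p (schroedinger r \<phi>))"
    by (intro gauss_family_schroedinger gauss_family_power_nonlinearity assms continuous_intros)
  have 2: "gauss_family (\<lambda>r. schroedinger (\<gamma> * t - r) (power_nonlinearity p (schroedinger r \<phi>)))"
    by (intro gauss_family_schroedinger 1 continuous_intros)
  show ?thesis
    unfolding Xi1_gauss_eq[OF assms] fourier_cmult
      fourier_average[OF 2 compact_Icc finite_measure_phase_measure sets_phase_measure AE_phase_measure]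
      fourier_schroedinger_gauss_family[OF 1] ..
qed

text \<open>The explicit formula exhibits the transform as an integral of a jointly measurable
  function over the parameter \<open>r\<close>. The Cauchy-Schwarz inequality below asks for this
  measurability.\<close>

lemma measurable_fourier_Xi1_gauss:
  fixes \<phi> :: "'a::euclidean_space \<Rightarrow> complex"
  assumes "gauss_family (\<lambda>_::real. \<phi>)"
  shows "fourier (Xi1 \<gamma> p \<phi> t) \<in> borel_measurable borel"
proof -
  interpret finite_measure "phase_measure \<gamma> t" by (rule finite_measure_phase_measure)
  have 1: "gauss_family (\<lambda>r. fourier (power_nonlinearity p (schroedinger r \<phi>)))"
    by (intro gauss_family_schroedinger gauss_family_power_nonlinearity gauss_family_fourier assms
        continuous_intros)
  define G where "G = (\<lambda>r \<xi>. cis (- (\<gamma> * t - r) * (norm \<xi>)\<^sup>2) *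
      fourier (power_nonlinearity p (schroedinger r \<phi>)) \<xi>)"
  have "gauss_family G"
    unfolding G_def by (intro gauss_family_cis 1 continuous_intros)
  from measurable_pair_swap[OF measurable_gauss_family[OF this]]
  have [measurable]: "(\<lambda>(\<xi>, r). G r \<xi>) \<in> borel_measurable (borel \<Otimes>\<^sub>M borel)"
    by (simp add: case_prod_unfold)
  have "(\<lambda>\<xi>. \<i> * of_real (sgn t) * (\<integral>r. G r \<xi> \<partial>phase_measure \<gamma> t)) \<in> borel_measurable borel"
    by measurable
  then have "(\<lambda>\<xi>. fourier (Xi1 \<gamma> p \<phi> t) \<xi>) \<in> borel_measurable borel"
    unfolding fourier_Xi1_gauss[OF assms] G_def .
  then show ?thesis .
qed

text \<open>Pairing with the free evolution of the datum turns the nonlinear expression into an integral of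
  the nonnegative quantity \<open>|schroedinger r \<phi>| ^ (p + 2)\<close>, so that no cancellation can occur.\<close>

lemma Xi1_gauss_pairing:
  fixes \<phi> :: "'a::euclidean_space \<Rightarrow> complex"
  assumes \<phi>: "gauss_family (\<lambda>_::real. \<phi>)"
  shows "(LBINT \<xi>. fourier (Xi1 \<gamma> p \<phi> t) \<xi> * cnj (cis (- (\<gamma> * t) * (norm \<xi>)\<^sup>2) * fourier \<phi> \<xi>))
    = \<i> * of_real (sgn t) *
      of_real (\<integral>r. (LBINT x. norm (schroedinger r \<phi> x) ^ (p + 2)) \<partial>phase_measure \<gamma> t)"
proof -
  let ?\<nu> = "phase_measure \<gamma> t"
  interpret finite_measure ?\<nu> by (rule finite_measure_phase_measure)
  interpret pair_sigma_finite ?\<nu> "lborel :: 'a measure" ..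
  define f where "f = (\<lambda>r. power_nonlinearity p (schroedinger r \<phi>))"
  have f: "gauss_family f" unfolding f_def
    by (intro gauss_family_schroedinger gauss_family_power_nonlinearity assms continuous_intros)
  have u: "gauss_family (\<lambda>r \<xi>. cis (- r * (norm \<xi>)\<^sup>2) * fourier \<phi> \<xi>)"
    by (intro gauss_family_cis gauss_family_fourier assms continuous_intros)
  obtain c a \<beta> where \<phi>h: "fourier \<phi> = gauss c a \<beta>" "Re a > 0"
    using gauss_family_fourier[OF \<phi>] by (elim gauss_familyE) blast
  have "(LBINT \<xi>. fourier (Xi1 \<gamma> p \<phi> t) \<xi> * cnj (cis (- (\<gamma> * t) * (norm \<xi>)\<^sup>2) * fourier \<phi> \<xi>))
     = (LBINT \<xi>. \<i> * of_real (sgn t) *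
         (\<integral>r. fourier (f r) \<xi> * cnj (cis (- r * (norm \<xi>)\<^sup>2) * fourier \<phi> \<xi>) \<partial>?\<nu>))"
  proof (rule Bochner_Integration.integral_cong[OF refl])
    fix \<xi> :: 'a
    define k where "k = cnj (cis (- (\<gamma> * t) * (norm \<xi>)\<^sup>2) * fourier \<phi> \<xi>)"
    have fX: "fourier (Xi1 \<gamma> p \<phi> t) \<xi> = \<i> * of_real (sgn t) *
      (\<integral>r. cis (- (\<gamma> * t - r) * (norm \<xi>)\<^sup>2) * fourier (f r) \<xi> \<partial>?\<nu>)"
      unfolding f_def by (rule fourier_Xi1_gauss[OF \<phi>])
    \<comment> \<open>The multipliers at times \<open>\<gamma> * t - r\<close> and, conjugated,
      \<open>\<gamma> * t\<close> combine to the conjugated multiplier at time \<open>r\<close>: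
      pairing with the evolution at the fixed time becomes, for each \<open>r\<close>, pairing with
      the evolution at time \<open>r\<close>.\<close>
    have eq: "fourier (f r) \<xi> * cnj (cis (- r * (norm \<xi>)\<^sup>2) * fourier \<phi> \<xi>)
        = cis (- (\<gamma> * t - r) * (norm \<xi>)\<^sup>2) * fourier (f r) \<xi> * k" for r
    proof -
      have "cis (- (\<gamma> * t - r) * (norm \<xi>)\<^sup>2) * cis ((\<gamma> * t) * (norm \<xi>)\<^sup>2) = cis (r * (norm \<xi>)\<^sup>2)"
        unfolding cis_mult by (rule arg_cong[of _ _ cis]) (simp add: algebra_simps)
      then show ?thesis by (simp add: k_def cis_cnj mult_ac)
    qed
    show "fourier (Xi1 \<gamma> p \<phi> t) \<xi> * cnj (cis (- (\<gamma> * t) * (norm \<xi>)\<^sup>2) * fourier \<phi> \<xi>)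
      = \<i> * of_real (sgn t) *
         (\<integral>r. fourier (f r) \<xi> * cnj (cis (- r * (norm \<xi>)\<^sup>2) * fourier \<phi> \<xi>) \<partial>?\<nu>)"
      unfolding eq integral_mult_left_zero fX k_def by (simp only: mult.assoc)
  qed
  also have "\<dots> = \<i> * of_real (sgn t) *
     (LBINT \<xi>. (\<integral>r. fourier (f r) \<xi> * cnj (cis (- r * (norm \<xi>)\<^sup>2) * fourier \<phi> \<xi>) \<partial>?\<nu>))"
    by (rule integral_mult_right_zero)
  also have "(LBINT \<xi>. (\<integral>r. fourier (f r) \<xi> * cnj (cis (- r * (norm \<xi>)\<^sup>2) * fourier \<phi> \<xi>) \<partial>?\<nu>))
     = (\<integral>r. (LBINT \<xi>. fourier (f r) \<xi> * cnj (cis (- r * (norm \<xi>)\<^sup>2) * fourier \<phi> \<xi>)) \<partial>?\<nu>)"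
  proof (rule Fubini_integral)
    obtain B where B: "\<And>\<xi>. norm (fourier \<phi> \<xi>) \<le> B"
      unfolding \<phi>h(1) using gauss_decay[OF \<phi>h(2), of 0] by auto
    have [measurable]: "cnj \<in> borel_measurable borel"
      by (intro borel_measurable_continuous_onI continuous_intros)
    note [measurable] = measurable_gauss_family[OF gauss_family_fourier[OF f]] measurable_gauss_family[OF u]
    show "integrable (?\<nu> \<Otimes>\<^sub>M lborel)
      (\<lambda>(r, \<xi>). fourier (f r) \<xi> * cnj (cis (- r * (norm \<xi>)\<^sup>2) * fourier \<phi> \<xi>))"
    proof (rule integrable_pair_gauss_family[OF gauss_family_fourier[OF f] compact_Icc
          finite_measure_phase_measure sets_phase_measure AE_phase_measure])
      show "(\<lambda>(r, \<xi>). fourier (f r) \<xi> * cnj (cis (- r * (norm \<xi>)\<^sup>2) * fourier \<phi> \<xi>))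
         \<in> borel_measurable (borel \<Otimes>\<^sub>M borel)"
        unfolding case_prod_unfold by measurable
      show "norm (case (r, \<xi>) of (r, \<xi>) \<Rightarrow>
          fourier (f r) \<xi> * cnj (cis (- r * (norm \<xi>)\<^sup>2) * fourier \<phi> \<xi>)) \<le> B * norm (fourier (f r) \<xi>)" for r \<xi>
        using mult_right_mono[OF B[of \<xi>], of "norm (fourier (f r) \<xi>)"]
        by (simp add: norm_mult mult.commute)
    qed
  qed
  also have "\<dots> = (\<integral>r. of_real (LBINT x. norm (schroedinger r \<phi> x) ^ (p + 2)) \<partial>?\<nu>)"
  proof (rule Bochner_Integration.integral_cong[OF refl])
    fix r
    have "(LBINT \<xi>. fourier (f r) \<xi> * cnj (cis (- r * (norm \<xi>)\<^sup>2) * fourier \<phi> \<xi>))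
       = (LBINT x. f r x * cnj (schroedinger r \<phi> x))"
      unfolding schroedinger_def
      by (rule parseval_fourier[OF integrable_gauss_family[OF f] integrable_gauss_family[OF u]])
    \<comment> \<open>Two further factors of the modulus come from multiplying the evolution by its
      own conjugate.\<close>
    also have "\<dots> = (LBINT x. of_real (norm (schroedinger r \<phi> x) ^ (p + 2)))"
      by (simp only: f_def power_nonlinearity_def power_add mult.assoc of_real_mult complex_norm_square)
    also have "\<dots> = of_real (LBINT x. norm (schroedinger r \<phi> x) ^ (p + 2))"
      by (rule integral_complex_of_real)
    finally show "(LBINT \<xi>. fourier (f r) \<xi> * cnj (cis (- r * (norm \<xi>)\<^sup>2) * fourier \<phi> \<xi>))
       = of_real (LBINT x. norm (schroedinger r \<phi> x) ^ (p + 2))" .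
  qed
  also have "\<dots> = of_real (\<integral>r. (LBINT x. norm (schroedinger r \<phi> x) ^ (p + 2)) \<partial>?\<nu>)"
    by (rule integral_complex_of_real)
  finally show ?thesis .
qed

section \<open>Gaussians are Schwartz functions\<close>

text \<open>Polynomials in the coordinates, generated by exactly the operations that arise when a
  polynomial multiple of a Gaussian is differentiated; growth and differentiability then follow by
  rule induction.\<close>

inductive poly_fun :: "('a::euclidean_space \<Rightarrow> complex) \<Rightarrow> bool" where
  const: "poly_fun (\<lambda>_. c)"
| inner: "poly_fun (\<lambda>x. of_real (x \<bullet> b))"
| add: "poly_fun P \<Longrightarrow> poly_fun Q \<Longrightarrow> poly_fun (\<lambda>x. P x + Q x)"
| mult: "poly_fun P \<Longrightarrow> poly_fun Q \<Longrightarrow> poly_fun (\<lambda>x. P x * Q x)"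

lemma poly_fun_growth:
  "poly_fun P \<Longrightarrow> \<exists>C k. C \<ge> 0 \<and> (\<forall>x. norm (P x) \<le> C * (1 + norm x) ^ k)"
proof (induction rule: poly_fun.induct)
  case (const c)
  show ?case by (intro exI[of _ "norm c"] exI[of _ 0]) auto
next
  case (inner b)
  have "norm (complex_of_real (x \<bullet> b)) \<le> norm b * (1 + norm x) ^ 1" for x
  proof -
    have "\<bar>x \<bullet> b\<bar> \<le> norm x * norm b" by (rule Cauchy_Schwarz_ineq2)
    then show ?thesis by (simp add: algebra_simps add_increasing)
  qed
  then show ?case by (intro exI[of _ "norm b"] exI[of _ 1]) simp
next
  case (add P Q)
  then obtain C k D l where *: "C \<ge> 0" "D \<ge> 0" "\<And>x. norm (P x) \<le> C * (1 + norm x) ^ k"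
    "\<And>x. norm (Q x) \<le> D * (1 + norm x) ^ l" by metis
  have "norm (P x + Q x) \<le> (C + D) * (1 + norm x) ^ (k + l)" for x
  proof -
    have "norm (P x + Q x) \<le> C * (1 + norm x) ^ k + D * (1 + norm x) ^ l"
      by (intro norm_triangle_le add_mono *)
    also have "\<dots> \<le> C * (1 + norm x) ^ (k + l) + D * (1 + norm x) ^ (k + l)"
      by (intro add_mono mult_left_mono power_increasing *) auto
    finally show ?thesis by (simp add: algebra_simps)
  qed
  then show ?case using * by (intro exI[of _ "C + D"] exI[of _ "k + l"]) auto
next
  case (mult P Q)
  then obtain C k D l where *: "C \<ge> 0" "D \<ge> 0" "\<And>x. norm (P x) \<le> C * (1 + norm x) ^ k"
    "\<And>x. norm (Q x) \<le> D * (1 + norm x) ^ l" by metis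
  have "norm (P x * Q x) \<le> (C * D) * (1 + norm x) ^ (k + l)" for x
  proof -
    have "norm (P x * Q x) \<le> (C * (1 + norm x) ^ k) * (D * (1 + norm x) ^ l)"
      unfolding norm_mult by (intro mult_mono *) (auto simp: *)
    then show ?thesis by (simp add: algebra_simps power_add)
  qed
  then show ?case using * by (intro exI[of _ "C * D"] exI[of _ "k + l"]) auto
qed

lemma poly_fun_has_derivative:
  "poly_fun P \<Longrightarrow> \<exists>D. (\<forall>x. (P has_derivative D x) (at x)) \<and> (\<forall>v. poly_fun (\<lambda>x. D x v))"
proof (induction rule: poly_fun.induct)
  case (const c)
  show ?case by (intro exI[of _ "\<lambda>_ _. 0"]) (auto intro: poly_fun.intros)
next
  case (inner b)
  show ?case
    by (intro exI[of _ "\<lambda>x v. of_real (v \<bullet> b)"])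
       (auto intro!: poly_fun.intros derivative_eq_intros)
next
  case (add P Q)
  then obtain D E where "\<And>x. (P has_derivative D x) (at x)" "\<And>v. poly_fun (\<lambda>x. D x v)"
     "\<And>x. (Q has_derivative E x) (at x)" "\<And>v. poly_fun (\<lambda>x. E x v)" by blast
  then show ?case
    by (intro exI[of _ "\<lambda>x v. D x v + E x v"]) (auto intro!: poly_fun.intros derivative_intros)
next
  case (mult P Q)
  then obtain D E where "\<And>x. (P has_derivative D x) (at x)" "\<And>v. poly_fun (\<lambda>x. D x v)"
     "\<And>x. (Q has_derivative E x) (at x)" "\<And>v. poly_fun (\<lambda>x. E x v)" by blast
  with mult.hyps show ?case
    by (intro exI[of _ "\<lambda>x v. P x * E x v + D x v * Q x"])
       (auto intro!: poly_fun.intros derivative_intros)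
qed

lemma has_derivative_gauss:
  "(gauss c a \<beta> has_derivative
     (\<lambda>v. (- 2 * a * of_real (x \<bullet> v) + \<beta> * of_real (v \<bullet> \<Sum>Basis)) * gauss c a \<beta> x)) (at x)"
proof -
  have "((\<lambda>x. - a * of_real (x \<bullet> x) + \<beta> * of_real (x \<bullet> \<Sum>Basis)) has_derivative
     (\<lambda>v. - 2 * a * of_real (x \<bullet> v) + \<beta> * of_real (v \<bullet> \<Sum>Basis))) (at x)"
    by (auto intro!: derivative_eq_intros simp: algebra_simps inner_commute)
  from has_derivative_mult_right[OF has_derivative_compose[OF this
      has_field_derivative_imp_has_derivative[OF DERIV_exp]], of c] show ?thesis
    unfolding gauss_def power2_norm_eq_inner by (simp add: algebra_simps)
qed

lemma poly_fun_mult_gauss_has_derivative: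
  assumes "poly_fun P"
  shows "\<exists>D. (\<forall>x. ((\<lambda>x. P x * gauss c a \<beta> x) has_derivative D x) (at x)) \<and>
    (\<forall>v. \<exists>Q. poly_fun Q \<and> (\<forall>x. D x v = Q x * gauss c a \<beta> x))"
proof -
  obtain D where D: "\<And>x. (P has_derivative D x) (at x)" "\<And>v. poly_fun (\<lambda>x. D x v)"
    using poly_fun_has_derivative[OF assms] by blast
  let ?Q = "\<lambda>v x. P x * ((- 2 * a) * of_real (x \<bullet> v) + \<beta> * of_real (v \<bullet> \<Sum>Basis)) + D x v"
  show ?thesis
  proof (intro exI conjI allI)
    show "((\<lambda>x. P x * gauss c a \<beta> x) has_derivative (\<lambda>v. ?Q v x * gauss c a \<beta> x)) (at x)" for x
      by (rule has_derivative_eq_rhs[OF has_derivative_mult[OF D(1) has_derivative_gauss]])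
         (simp add: algebra_simps)
    show "poly_fun (?Q v)" for v
      by (intro poly_fun.intros assms D)
  qed auto
qed

text \<open>The induction closes because a derivative in a fixed direction changes only the
  polynomial factor.\<close>

lemma iter_deriv_gauss:
  "\<exists>P. poly_fun P \<and> iter_deriv bs (gauss c a \<beta>) = (\<lambda>x. P x * gauss c a \<beta> x)"
proof (induction bs)
  case Nil
  show ?case by (intro exI[of _ "\<lambda>_. 1"]) (auto intro: poly_fun.intros)
next
  case (Cons b bs)
  then obtain P where P: "poly_fun P" "iter_deriv bs (gauss c a \<beta>) = (\<lambda>x. P x * gauss c a \<beta> x)"
    by blast
  from poly_fun_mult_gauss_has_derivative[OF P(1), of c a \<beta>]
  obtain D Q where DQ: "\<And>x. ((\<lambda>x. P x * gauss c a \<beta> x) has_derivative D x) (at x)"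
    "poly_fun Q" "\<And>x. D x b = Q x * gauss c a \<beta> x" by blast
  have "frechet_derivative (\<lambda>x. P x * gauss c a \<beta> x) (at x) = D x" for x
    by (rule frechet_derivative_at[symmetric, OF DQ(1)])
  with DQ(2,3) P(2) show ?case by auto
qed

lemma schwartz_gauss:
  assumes "Re a > 0"
  shows "schwartz (gauss c a \<beta>)"
  unfolding schwartz_def
proof (intro allI impI conjI)
  fix bs :: "'a list" and x :: 'a and k :: nat
  obtain P where P: "poly_fun P" "iter_deriv bs (gauss c a \<beta>) = (\<lambda>x. P x * gauss c a \<beta> x)"
    using iter_deriv_gauss by blast
  show "iter_deriv bs (gauss c a \<beta>) differentiable (at x)"
    using poly_fun_mult_gauss_has_derivative[OF P(1)] unfolding P(2) differentiable_def by blast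
  obtain C l where C: "C \<ge> 0" "\<And>x. norm (P x) \<le> C * (1 + norm x) ^ l"
    using poly_fun_growth[OF P(1)] by blast
  \<comment> \<open>Decay of order \<open>k + l\<close> pays for both the Schwartz weight and the
    growth of \<open>P\<close>.\<close>
  obtain B where B: "\<And>x::'a. (1 + norm x) ^ (k + l) * norm (gauss c a \<beta> x) \<le> B"
    using gauss_decay[OF assms] by blast
  have "norm ((1 + norm x) ^ k *\<^sub>R (P x * gauss c a \<beta> x)) \<le> C * B" for x
  proof -
    have "norm ((1 + norm x) ^ k *\<^sub>R (P x * gauss c a \<beta> x))
        = (1 + norm x) ^ k * norm (P x) * norm (gauss c a \<beta> x)"
      by (simp add: norm_mult)
    also have "\<dots> \<le> (1 + norm x) ^ k * (C * (1 + norm x) ^ l) * norm (gauss c a \<beta> x)"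
      by (intro mult_right_mono mult_left_mono C) auto
    also have "\<dots> = C * ((1 + norm x) ^ (k + l) * norm (gauss c a \<beta> x))"
      by (simp add: power_add algebra_simps)
    also have "\<dots> \<le> C * B" by (intro mult_left_mono B C)
    finally show ?thesis .
  qed
  then show "bounded (range (\<lambda>x. (1 + norm x) ^ k *\<^sub>R iter_deriv bs (gauss c a \<beta>) x))"
    unfolding P(2) bounded_iff by blast
qed

section \<open>Lower bound for the pairing\<close>

text \<open>For \<tau> between 0 and \<open>t\<close> the number \<open>\<gamma> * \<tau>\<close> is
  negative, so positive \<sigma> can compensate it. Each \<tau> in an interval of length
  \<open>m\<close> admits an interval of \<sigma> of length \<delta> with phase in the window, and
  Fubini multiplies the two lengths.\<close>

lemma measure_phase_measure_ge:
  assumes neg: "\<gamma> * t < 0" and \<delta>: "0 < \<delta>" "\<delta> \<le> 1 / 2"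
  shows "measure (phase_measure \<gamma> t) {- \<delta>..\<delta>} \<ge> min \<bar>t\<bar> (1 / (2 * \<bar>\<gamma>\<bar>)) * \<delta>"
proof -
  define M1 where "M1 = restrict_space lborel {min 0 t<..<max 0 t}"
  define M2 where "M2 = restrict_space lborel {0<..<1::real}"
  interpret M1: finite_measure M1 unfolding M1_def by (rule finite_measure_restrict_Ioo)
  interpret M2: finite_measure M2 unfolding M2_def by (rule finite_measure_restrict_Ioo)
  interpret \<nu>: finite_measure "phase_measure \<gamma> t" by (rule finite_measure_phase_measure)
  \<comment> \<open>The bound \<open>\<bar>t\<bar>\<close> keeps \<tau> in the domain of
    integration; \<open>1 / (2 * \<bar>\<gamma>\<bar>)\<close> keeps
    \<open>\<bar>\<gamma> * \<tau>\<bar>\<close> below one half.\<close>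
  define m where "m = min \<bar>t\<bar> (1 / (2 * \<bar>\<gamma>\<bar>))"
  have \<gamma>: "\<gamma> \<noteq> 0" "t \<noteq> 0" using neg by auto
  have m: "m > 0" using \<gamma> by (simp add: m_def)
  define J where "J = (if t > 0 then {0<..<m} else {- m<..<0})"
  have J: "J \<subseteq> {min 0 t<..<max 0 t}" "J \<in> sets borel" "emeasure lborel J = ennreal m"
    using m \<gamma>(2) by (auto simp: J_def m_def)
  have ph: "(\<lambda>(\<tau>, \<sigma>). \<gamma> * \<tau> + \<sigma>) \<in> M1 \<Otimes>\<^sub>M M2 \<rightarrow>\<^sub>M borel"
    unfolding M1_def M2_def by (rule measurable_phase)
  define A where "A = (\<lambda>(\<tau>, \<sigma>). \<gamma> * \<tau> + \<sigma>) -` {- \<delta>..\<delta>} \<inter> space (M1 \<Otimes>\<^sub>M M2)"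
  have A: "A \<in> sets (M1 \<Otimes>\<^sub>M M2)"
    unfolding A_def by (rule measurable_sets[OF ph]) simp
  have slice: "ennreal \<delta> \<le> emeasure M2 (Pair \<tau> -` A)" if \<tau>: "\<tau> \<in> J" for \<tau>
  proof -
    define y where "y = - (\<gamma> * \<tau>)"
    have \<tau>m: "\<bar>\<tau>\<bar> < m" using \<tau> by (auto simp: J_def split: if_splits)
    have "\<bar>\<gamma>\<bar> * \<bar>\<tau>\<bar> < \<bar>\<gamma>\<bar> * (1 / (2 * \<bar>\<gamma>\<bar>))"
      by (rule mult_strict_left_mono) (use \<tau>m \<gamma> in \<open>auto simp: m_def\<close>)
    then have "\<bar>y\<bar> < 1 / 2" using \<gamma> by (simp add: y_def abs_mult)
    moreover have "y > 0"
      using \<tau> neg by (auto simp: y_def J_def mult_less_0_iff split: if_splits)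
    ultimately have y: "0 < y" "y < 1 / 2" by auto
    have \<tau>1: "\<tau> \<in> {min 0 t<..<max 0 t}" using \<tau> J(1) by blast
    \<comment> \<open>Here the phase is \<open>\<sigma> - y\<close>, which lies between 0 and
      \<delta>; since \<open>y\<close> is below and \<delta> at most one half, \<sigma> stays below
      1.\<close>
    have sub: "{y<..<y + \<delta>} \<subseteq> Pair \<tau> -` A"
    proof
      fix \<sigma> assume "\<sigma> \<in> {y<..<y + \<delta>}"
      then show "\<sigma> \<in> Pair \<tau> -` A"
        using y \<delta> \<tau>1 unfolding A_def M1_def M2_def space_phase_domain y_def by auto
    qed
    have "ennreal \<delta> = emeasure lborel {y<..<y + \<delta>}" using \<delta> by simp
    also have "\<dots> = emeasure M2 {y<..<y + \<delta>}"
      unfolding M2_def by (rule emeasure_restrict_space[symmetric]) (use y \<delta> in auto)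
    also have "\<dots> \<le> emeasure M2 (Pair \<tau> -` A)"
      by (rule emeasure_mono[OF sub sets_Pair1[OF A]])
    finally show ?thesis .
  qed
  have "ennreal (m * \<delta>) = ennreal \<delta> * emeasure M1 J"
    using m \<delta> J unfolding M1_def
    by (subst emeasure_restrict_space) (auto simp: mult.commute ennreal_mult)
  also have "\<dots> = (\<integral>\<^sup>+ \<tau>. ennreal \<delta> * indicator J \<tau> \<partial>M1)"
    by (rule nn_integral_cmult_indicator[symmetric])
       (use J in \<open>auto simp: M1_def sets_restrict_space\<close>)
  also have "\<dots> \<le> (\<integral>\<^sup>+ \<tau>. emeasure M2 (Pair \<tau> -` A) \<partial>M1)"
    by (rule nn_integral_mono) (auto simp: indicator_def slice)
  also have "\<dots> = emeasure (M1 \<Otimes>\<^sub>M M2) A"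
    by (rule M2.emeasure_pair_measure_alt[OF A, symmetric])
  also have "\<dots> = emeasure (phase_measure \<gamma> t) {- \<delta>..\<delta>}"
    unfolding phase_measure_def A_def M1_def[symmetric] M2_def[symmetric]
    by (rule emeasure_distr[OF ph, symmetric]) simp
  finally show ?thesis
    using m \<delta> unfolding m_def[symmetric] \<nu>.emeasure_eq_measure by (simp add: ennreal_le_iff)
qed

section \<open>Translated Gaussians and the free evolution of the test datum\<close>

lemma norm_One_power2: "(norm (\<Sum>Basis :: 'a::euclidean_space))\<^sup>2 = real DIM('a)"
  unfolding norm_power2_eq_sum_Basis by simp

lemma norm_diff_One_power2:
  "(norm (x - m *\<^sub>R \<Sum>Basis))\<^sup>2
     = (norm (x :: 'a::euclidean_space))\<^sup>2 - 2 * m * (x \<bullet> \<Sum>Basis) + m\<^sup>2 * real DIM('a)"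
proof -
  have "(norm (x - m *\<^sub>R \<Sum>Basis))\<^sup>2
      = (norm x)\<^sup>2 - 2 * m * (x \<bullet> \<Sum>Basis) + m\<^sup>2 * (norm (\<Sum>Basis :: 'a))\<^sup>2"
    unfolding power2_norm_eq_inner
    by (simp only: inner_diff_left inner_diff_right inner_scaleR_left inner_scaleR_right
        power2_eq_square inner_commute[of "\<Sum>Basis" x]) (simp add: algebra_simps)
  then show ?thesis by (simp only: norm_One_power2)
qed

lemma
  fixes m \<kappa> :: real
  assumes \<kappa>: "\<kappa> > 0"
  shows integrable_exp_norm_diff: "integrable lborel
      (\<lambda>x::'a::euclidean_space. exp (- \<kappa> * (norm (x - m *\<^sub>R \<Sum>Basis))\<^sup>2))" (is ?int)
    and integral_exp_norm_diff: "(LBINT x::'a. exp (- \<kappa> * (norm (x - m *\<^sub>R \<Sum>Basis))\<^sup>2))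
      = sqrt (pi / \<kappa>) ^ DIM('a)" (is ?eq)
proof -
  let ?d = "real DIM('a)"
  let ?g = "gauss (of_real (exp (- \<kappa> * (m\<^sup>2 * ?d)))) (of_real \<kappa>) (of_real (2 * \<kappa> * m)) :: 'a \<Rightarrow> complex"
  have eq: "complex_of_real (exp (- \<kappa> * (norm (x - m *\<^sub>R \<Sum>Basis))\<^sup>2)) = ?g x" for x :: 'a
  proof -
    have "- \<kappa> * (norm (x - m *\<^sub>R \<Sum>Basis))\<^sup>2
        = - \<kappa> * (m\<^sup>2 * ?d) + (- \<kappa> * (norm x)\<^sup>2 + 2 * \<kappa> * m * (x \<bullet> \<Sum>Basis))"
      unfolding norm_diff_One_power2 by (simp add: algebra_simps)
    then show ?thesis
      unfolding gauss_def
      by (simp only: exp_add of_real_mult of_real_minus[symmetric] of_real_add exp_of_real[symmetric])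
  qed
  have int: "integrable lborel (\<lambda>x::'a. complex_of_real (exp (- \<kappa> * (norm (x - m *\<^sub>R \<Sum>Basis))\<^sup>2)))"
    unfolding eq using \<kappa> by (intro integrable_gauss) simp
  then show ?int by (simp only: complex_of_real_integrable_eq)
  have "complex_of_real (LBINT x::'a. exp (- \<kappa> * (norm (x - m *\<^sub>R \<Sum>Basis))\<^sup>2)) = integral\<^sup>L lborel ?g"
    unfolding integral_complex_of_real[symmetric] eq ..
  also have "\<dots> = of_real (exp (- \<kappa> * (m\<^sup>2 * ?d))) * (of_real (sqrt pi) / csqrt (of_real \<kappa>)) ^ DIM('a) *
      exp (of_nat DIM('a) * (of_real (2 * \<kappa> * m))\<^sup>2 / (4 * of_real \<kappa>))"
    by (rule integral_gauss) (use \<kappa> in simp)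
  also have "of_nat DIM('a) * (complex_of_real (2 * \<kappa> * m))\<^sup>2 / (4 * of_real \<kappa>) = of_real (\<kappa> * (m\<^sup>2 * ?d))"
    using \<kappa> by (simp add: power2_eq_square field_simps)
  also have "of_real (sqrt pi) / csqrt (of_real \<kappa>) = complex_of_real (sqrt (pi / \<kappa>))"
    using \<kappa> by (simp add: real_sqrt_divide)
  also have "of_real (exp (- \<kappa> * (m\<^sup>2 * ?d))) * complex_of_real (sqrt (pi / \<kappa>)) ^ DIM('a) *
      exp (of_real (\<kappa> * (m\<^sup>2 * ?d))) = of_real (sqrt (pi / \<kappa>) ^ DIM('a))"
  proof -
    have "exp (- \<kappa> * (m\<^sup>2 * ?d)) * exp (\<kappa> * (m\<^sup>2 * ?d)) = 1"
      by (simp flip: exp_add)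
    then have "exp (- \<kappa> * (m\<^sup>2 * ?d)) * sqrt (pi / \<kappa>) ^ DIM('a) * exp (\<kappa> * (m\<^sup>2 * ?d))
        = sqrt (pi / \<kappa>) ^ DIM('a)" by (metis mult.commute mult.left_commute mult_1_right)
    then show ?thesis
      by (simp only: exp_of_real of_real_mult[symmetric] of_real_power[symmetric])
  qed
  finally show ?eq by (simp only: of_real_eq_iff)
qed

lemma norm_fourier_gauss_const:
  "norm (fourier_gauss_const d a \<beta>) = (1 / sqrt (2 * norm a)) ^ d * exp (real d * Re (\<beta>\<^sup>2 / (4 * a)))"
proof -
  have "Re (of_nat d * \<beta>\<^sup>2 / (4 * a)) = real d * Re (\<beta>\<^sup>2 / (4 * a))"
    by (simp flip: times_divide_eq_right)
  moreover have "norm (csqrt a) = sqrt (norm a)"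
    by (metis power2_csqrt norm_power norm_ge_zero real_sqrt_unique)
  ultimately show ?thesis
    unfolding fourier_gauss_const_def
    by (simp add: norm_mult norm_power norm_divide real_sqrt_mult)
qed

text \<open>A Gaussian concentrated at scale \<open>1 / N\<close> in space, with frequencies at distance about \<open>N\<close>
  from \<open>M One\<close>.\<close>

definition test_datum :: "real \<Rightarrow> real \<Rightarrow> 'a::euclidean_space \<Rightarrow> complex" where
  "test_datum N M = gauss 1 (of_real (N\<^sup>2 / 2)) (\<i> * of_real M)"

lemma gauss_family_test_datum: "N > 0 \<Longrightarrow> gauss_family (\<lambda>_. test_datum N M)"
  unfolding test_datum_def by (rule gauss_family_const) simp

lemma schwartz_test_datum: "N > 0 \<Longrightarrow> schwartz (test_datum N M)"
  unfolding test_datum_def by (rule schwartz_gauss) simp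

lemma fourier_test_datum:
  assumes "N > 0"
  shows "fourier (test_datum N M :: 'a::euclidean_space \<Rightarrow> complex)
    = gauss (fourier_gauss_const DIM('a) (of_real (N\<^sup>2 / 2)) (\<i> * of_real M))
        (of_real (1 / (2 * N\<^sup>2))) (of_real (M / N\<^sup>2))"
proof -
  have "1 / (4 * complex_of_real (N\<^sup>2 / 2)) = of_real (1 / (2 * N\<^sup>2))"
    "- \<i> * (\<i> * complex_of_real M) / (2 * of_real (N\<^sup>2 / 2)) = of_real (M / N\<^sup>2)"
    by (auto simp: field_simps)
  then show ?thesis
    unfolding test_datum_def using assms by (subst fourier_gauss) auto
qed

lemma norm_test_datum_const:
  assumes "N > 0"
  shows "norm (fourier_gauss_const d (of_real (N\<^sup>2 / 2)) (\<i> * of_real M))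
    = (1 / N) ^ d * exp (- (M\<^sup>2 * real d / (2 * N\<^sup>2)))"
proof -
  have "(\<i> * complex_of_real M)\<^sup>2 / (4 * of_real (N\<^sup>2 / 2)) = of_real (- (M\<^sup>2 / (2 * N\<^sup>2)))"
    by (simp add: power_mult_distrib)
  then have "Re ((\<i> * complex_of_real M)\<^sup>2 / (4 * of_real (N\<^sup>2 / 2))) = - (M\<^sup>2 / (2 * N\<^sup>2))"
    by (simp only: Re_complex_of_real)
  moreover have "sqrt (2 * norm (complex_of_real (N\<^sup>2 / 2))) = N"
    using assms by (simp only: norm_of_real) simp
  ultimately show ?thesis
    unfolding norm_fourier_gauss_const by (simp add: mult.commute)
qed

lemma norm_fourier_test_datum:
  assumes "N > 0"
  shows "norm (fourier (test_datum N M) (\<xi> :: 'a::euclidean_space))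
    = (1 / N) ^ DIM('a) * exp (- ((norm (\<xi> - M *\<^sub>R \<Sum>Basis))\<^sup>2 / (2 * N\<^sup>2)))"
proof -
  have "- (M\<^sup>2 * real DIM('a) / (2 * N\<^sup>2)) + (- (1 / (2 * N\<^sup>2)) * (norm \<xi>)\<^sup>2 + M / N\<^sup>2 * (\<xi> \<bullet> \<Sum>Basis))
      = - ((norm (\<xi> - M *\<^sub>R \<Sum>Basis))\<^sup>2 / (2 * N\<^sup>2))"
    unfolding norm_diff_One_power2 using assms by (simp add: field_simps)
  then show ?thesis
    by (simp only: fourier_test_datum[OF assms] norm_gauss norm_test_datum_const[OF assms]
        Re_complex_of_real mult.assoc exp_add[symmetric])
qed

text \<open>Galilean invariance in explicit form: the shift \<open>M / N\<^sup>2 * w\<close> equals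
  \<open>2 * M * r\<close>, motion with velocity \<open>2 * M\<close> along the diagonal, and
  \<open>M\<close> enters nowhere else. The variable \<open>w\<close> is time in units of the
  dispersive scale of the packet.\<close>

lemma norm_schroedinger_test_datum:
  fixes x :: "'a::euclidean_space" and r N M w :: real
  assumes N: "N > 0"
  defines "w \<equiv> 2 * N\<^sup>2 * r"
  shows "norm (schroedinger r (test_datum N M) x)
    = (1 / sqrt (sqrt (1 + w\<^sup>2))) ^ DIM('a) *
      exp (- (N\<^sup>2 / (2 * (1 + w\<^sup>2))) * (norm (x - (M / N\<^sup>2 * w) *\<^sub>R \<Sum>Basis))\<^sup>2)"
proof -
  define b where "b = M / N\<^sup>2"
  define a1 where "a1 = complex_of_real (1 / (2 * N\<^sup>2)) + \<i> * of_real r"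
  define k where "k = fourier_gauss_const DIM('a) (of_real (N\<^sup>2 / 2)) (\<i> * of_real M)"
  define \<rho> where "\<rho> = N\<^sup>2 / (2 * (1 + w\<^sup>2))"
  have Re_a1: "Re a1 > 0" using N by (simp add: a1_def)
  have w1: "1 + w\<^sup>2 > 0" by (simp add: add_pos_nonneg)
  have a1: "a1 = (1 + \<i> * of_real w) / of_real (2 * N\<^sup>2)"
    using N by (simp add: a1_def w_def field_simps)
  have sq: "(1 + \<i> * of_real w) * (1 - \<i> * of_real w) = complex_of_real (1 + w\<^sup>2)"
    by (simp add: algebra_simps power2_eq_square)
  \<comment> \<open>Rationalising with the conjugate of \<open>1 + \<i> * of_real w\<close>
    separates the real and imaginary parts of the evolved rate.\<close>
  have inv: "1 / (4 * a1) = of_real \<rho> * (1 - \<i> * of_real w)"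
  proof -
    have "of_real \<rho> * (1 - \<i> * of_real w) * (4 * a1)
        = of_real \<rho> * (4 / of_real (2 * N\<^sup>2)) * ((1 + \<i> * of_real w) * (1 - \<i> * of_real w))"
      unfolding a1 by (simp only: times_divide_eq_left times_divide_eq_right mult_ac)
    also have "\<dots> = of_real (\<rho> * (4 / (2 * N\<^sup>2)) * (1 + w\<^sup>2))"
      unfolding sq by simp
    also have "\<rho> * (4 / (2 * N\<^sup>2)) * (1 + w\<^sup>2) = 1"
      using N w1 by (simp add: \<rho>_def field_simps)
    finally have "of_real \<rho> * (1 - \<i> * of_real w) * (4 * a1) = 1" by simp
    moreover have "4 * a1 \<noteq> 0" using Re_a1 by auto
    ultimately show ?thesis by (metis nonzero_divide_eq_eq)
  qed
  have Re1: "Re (1 / (4 * a1)) = \<rho>" unfolding inv by simp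
  have Re2: "Re (\<i> * of_real b / (2 * a1)) = 2 * \<rho> * b * w"
  proof -
    have "\<i> * of_real b / (2 * a1) = 2 * \<i> * of_real b * (1 / (4 * a1))" by simp
    then show ?thesis unfolding inv by simp
  qed
  have Re3: "Re ((of_real b)\<^sup>2 / (4 * a1)) = b\<^sup>2 * \<rho>"
  proof -
    have "(of_real b)\<^sup>2 / (4 * a1) = of_real (b\<^sup>2) * (1 / (4 * a1))" by simp
    then show ?thesis unfolding inv by simp
  qed
  have na: "sqrt (2 * norm a1) = sqrt (sqrt (1 + w\<^sup>2)) / N"
  proof -
    have "2 * norm a1 = sqrt (1 + w\<^sup>2) / N\<^sup>2"
    proof -
      have "norm (1 + \<i> * of_real w) = sqrt (1 + w\<^sup>2)" by (simp add: cmod_def)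
      moreover have "norm (complex_of_real (2 * N\<^sup>2)) = 2 * N\<^sup>2" by (simp only: norm_of_real) simp
      ultimately show ?thesis unfolding a1 by (simp only: norm_divide)
    qed
    then show ?thesis using N by (simp add: real_sqrt_divide)
  qed
  have nk: "norm k = (1 / N) ^ DIM('a) * exp (- (M\<^sup>2 * real DIM('a) / (2 * N\<^sup>2)))"
    unfolding k_def by (rule norm_test_datum_const[OF N])
  have "schroedinger r (test_datum N M) = inv_fourier (gauss k a1 (of_real b) :: 'a \<Rightarrow> complex)"
    unfolding schroedinger_def fourier_test_datum[OF N] cis_mult_gauss k_def a1_def b_def ..
  also have "\<dots> = gauss (k * fourier_gauss_const DIM('a) a1 (of_real b)) (1 / (4 * a1))
      (\<i> * of_real b / (2 * a1))"
    by (rule inv_fourier_gauss[OF Re_a1])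
  finally have "norm (schroedinger r (test_datum N M) x)
      = (1 / N) ^ DIM('a) * exp (- (M\<^sup>2 * real DIM('a) / (2 * N\<^sup>2))) *
        ((N / sqrt (sqrt (1 + w\<^sup>2))) ^ DIM('a) * exp (real DIM('a) * (b\<^sup>2 * \<rho>))) *
        exp (- \<rho> * (norm x)\<^sup>2 + 2 * \<rho> * b * w * (x \<bullet> \<Sum>Basis))"
    by (simp only: norm_gauss norm_mult nk norm_fourier_gauss_const Re1 Re2 Re3 na) simp
  also have "\<dots> = ((1 / N) ^ DIM('a) * (N / sqrt (sqrt (1 + w\<^sup>2))) ^ DIM('a)) *
      exp (- (M\<^sup>2 * real DIM('a) / (2 * N\<^sup>2)) + real DIM('a) * (b\<^sup>2 * \<rho>) +
        (- \<rho> * (norm x)\<^sup>2 + 2 * \<rho> * b * w * (x \<bullet> \<Sum>Basis)))"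
    by (simp only: exp_add mult_ac)
  also have "(1 / N) ^ DIM('a) * (N / sqrt (sqrt (1 + w\<^sup>2))) ^ DIM('a) = (1 / sqrt (sqrt (1 + w\<^sup>2))) ^ DIM('a)"
    using N by (simp flip: power_mult_distrib)
  also have "- (M\<^sup>2 * real DIM('a) / (2 * N\<^sup>2)) + real DIM('a) * (b\<^sup>2 * \<rho>) +
        (- \<rho> * (norm x)\<^sup>2 + 2 * \<rho> * b * w * (x \<bullet> \<Sum>Basis))
      = - \<rho> * (norm (x - (b * w) *\<^sub>R \<Sum>Basis))\<^sup>2"
  proof -
    \<comment> \<open>This identity leaves just \<open>\<rho> * b\<^sup>2 * w\<^sup>2\<close> times
      the dimension from the two constant exponents, the term that completes the square.\<close>
    have \<rho>w: "\<rho> * (1 + w\<^sup>2) = N\<^sup>2 / 2"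
      using w1 by (simp add: \<rho>_def field_simps)
    have "M\<^sup>2 / (2 * N\<^sup>2) = b\<^sup>2 * N\<^sup>2 / 2"
      using N by (simp add: b_def power2_eq_square)
    also have "\<dots> = b\<^sup>2 * (\<rho> * (1 + w\<^sup>2))"
      unfolding \<rho>w by simp
    finally have "M\<^sup>2 * real DIM('a) / (2 * N\<^sup>2) = b\<^sup>2 * (\<rho> * (1 + w\<^sup>2)) * real DIM('a)"
      by (metis times_divide_eq_left)
    then show ?thesis
      unfolding norm_diff_One_power2 by (simp add: algebra_simps power2_eq_square)
  qed
  finally show ?thesis unfolding \<rho>_def b_def .
qed

text \<open>In the window \<open>\<bar>w\<bar> \<le> 2\<close>, hence the constant 5 in the loss of
  height; the spreading of the packet only enlarges the integral, so its initial width serves as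
  lower bound.\<close>

lemma power_integral_schroedinger_test_datum_ge:
  assumes N: "N > 0" and r: "\<bar>r\<bar> * N\<^sup>2 \<le> 1" and q: "q > 0"
  shows "(LBINT x::'a::euclidean_space. norm (schroedinger r (test_datum N M) x) ^ q)
    \<ge> ((1 / sqrt (sqrt 5)) ^ DIM('a)) ^ q * sqrt (2 * pi / real q) ^ DIM('a) * (1 / N) ^ DIM('a)"
proof -
  define w where "w = 2 * N\<^sup>2 * r"
  define \<rho> where "\<rho> = N\<^sup>2 / (2 * (1 + w\<^sup>2))"
  have w1: "1 + w\<^sup>2 > 0" by (simp add: add_pos_nonneg)
  have "\<bar>w\<bar> \<le> 2" using r by (simp add: w_def abs_mult mult_ac)
  then have w5: "1 + w\<^sup>2 \<le> 5"
    using abs_le_square_iff[of w 2] by simp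
  have \<rho>: "\<rho> > 0" using N w1 by (simp add: \<rho>_def)
  have "norm (schroedinger r (test_datum N M) x) ^ q
      = ((1 / sqrt (sqrt (1 + w\<^sup>2))) ^ DIM('a)) ^ q *
        exp (- (real q * \<rho>) * (norm (x - (M / N\<^sup>2 * w) *\<^sub>R \<Sum>Basis))\<^sup>2)" for x :: 'a
    unfolding norm_schroedinger_test_datum[OF N] w_def[symmetric] \<rho>_def[symmetric] power_mult_distrib
    by (simp add: mult.assoc flip: exp_of_nat_mult)
  then have "(LBINT x::'a. norm (schroedinger r (test_datum N M) x) ^ q)
      = ((1 / sqrt (sqrt (1 + w\<^sup>2))) ^ DIM('a)) ^ q * sqrt (pi / (real q * \<rho>)) ^ DIM('a)"
    using integral_exp_norm_diff[of "real q * \<rho>" "M / N\<^sup>2 * w", where 'a = 'a] \<rho> q by simp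
  also have "\<dots> \<ge> ((1 / sqrt (sqrt 5)) ^ DIM('a)) ^ q * sqrt (2 * pi / (real q * N\<^sup>2)) ^ DIM('a)"
  proof (intro mult_mono power_mono)
    show "1 / sqrt (sqrt 5) \<le> 1 / sqrt (sqrt (1 + w\<^sup>2))"
      using w1 w5 by (intro divide_left_mono mult_pos_pos) auto
    have "\<rho> \<le> N\<^sup>2 / 2"
      unfolding \<rho>_def by (intro divide_left_mono) (use w1 in auto)
    then have "2 * pi / (real q * N\<^sup>2) \<le> pi / (real q * \<rho>)"
      using \<rho> q N by (simp add: field_simps)
    then show "sqrt (2 * pi / (real q * N\<^sup>2)) \<le> sqrt (pi / (real q * \<rho>))" by simp
  qed (use w1 \<rho> in auto)
  also have "sqrt (2 * pi / (real q * N\<^sup>2)) = sqrt (2 * pi / real q) * (1 / N)"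
    using N by (simp add: real_sqrt_divide real_sqrt_mult)
  finally show ?thesis by (simp only: power_mult_distrib mult.assoc)
qed

section \<open>Sobolev norms of modulated Gaussians\<close>

text \<open>The inequality \<open>y / (2 * A) \<le> exp (y / (2 * A))\<close> raised to the power
  \<open>A\<close>; the division makes \<open>A = 0\<close> a separate case.\<close>

lemma powr_le_exp_half:
  assumes "A \<ge> 0"
  obtains K where "K > 0" "\<And>y::real. y > 0 \<Longrightarrow> y powr A \<le> K * exp (y / 2)"
proof (cases "A = 0")
  case True
  show ?thesis by (rule that[of 1]) (auto simp: True)
next
  case False
  then have A: "A > 0" using assms by simp
  show ?thesis
  proof (rule that[of "(2 * A) powr A"])
    show "(2 * A) powr A > 0" using A by simp
    fix y :: real assume y: "y > 0"
    have "y / (2 * A) \<le> exp (y / (2 * A))"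
      using exp_ge_add_one_self[of "y / (2 * A)"] by linarith
    then have "(y / (2 * A)) powr A \<le> exp (y / (2 * A)) powr A"
      using A y by (intro powr_mono2) auto
    also have "\<dots> = exp (y / 2)" using A by (simp add: powr_def)
    finally have "(2 * A) powr A * (y / (2 * A)) powr A \<le> (2 * A) powr A * exp (y / 2)"
      using A by (intro mult_left_mono) auto
    moreover have "(2 * A) powr A * (y / (2 * A)) powr A = y powr A"
      using A y by (simp flip: powr_mult)
    ultimately show "y powr A \<le> (2 * A) powr A * exp (y / 2)" by simp
  qed
qed

text \<open>Two-sided comparability with 1 lets positive and negative Sobolev exponents be treated
  together.\<close>

lemma powr_le_powr_abs:
  fixes y L r :: real
  assumes "1 / L \<le> y" "y \<le> L" "L \<ge> 1"
  shows "y powr r \<le> L powr \<bar>r\<bar>"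
proof (cases "r \<ge> 0")
  case True
  then show ?thesis using assms by (auto intro!: powr_mono2 order_trans[OF _ assms(1)])
next
  case False
  have L: "1 / L > 0" using assms by simp
  have "y powr r \<le> (1 / L) powr r"
    using False assms L by (intro powr_mono2') auto
  also have "\<dots> = L powr \<bar>r\<bar>"
    using False assms by (simp add: powr_divide powr_minus_divide[symmetric])
  finally show ?thesis .
qed

text \<open>Since \<open>M = N powr (1 + \<epsilon>)\<close> is much larger than the width \<open>N\<close> of the Gaussian, the
  Sobolev weight may be frozen at the centre \<open>M One\<close>, at the cost of half of the Gaussian decay.\<close>

lemma sobolev_weight_le:
  assumes \<epsilon>: "\<epsilon> > 0"
  obtains K where "K > 0"
    "\<And>N \<xi>. N \<ge> 1 \<Longrightarrow> (1 + (norm (\<xi>::'a::euclidean_space))\<^sup>2) powr r \<le>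
       K * ((N powr (1 + \<epsilon>))\<^sup>2) powr r * exp ((norm (\<xi> - N powr (1 + \<epsilon>) *\<^sub>R \<Sum>Basis))\<^sup>2 / (2 * N\<^sup>2))"
proof -
  define d where "d = real DIM('a)"
  have d: "d \<ge> 1" using DIM_positive[where 'a = 'a] unfolding d_def by linarith
  \<comment> \<open>Far from the centre \<open>z\<^sup>2\<close> is bounded by a constant times
    \<open>y powr (1 + 1 / \<epsilon>)\<close>; raising this to the power
    \<open>\<bar>r\<bar>\<close> produces \<open>A\<close>.\<close>
  define A where "A = \<bar>r\<bar> * (1 + 1 / \<epsilon>)"
  have A: "A \<ge> 0" using \<epsilon> by (simp add: A_def)
  obtain K0 where K0: "K0 > 0" "\<And>y::real. y > 0 \<Longrightarrow> y powr A \<le> K0 * exp (y / 2)"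
    using powr_le_exp_half[OF A] by blast
  define K1 where "K1 = (13 * 4 powr (1 / \<epsilon>)) powr \<bar>r\<bar> * K0"
  define K where "K = K1 + (4 * d) powr \<bar>r\<bar>"
  show ?thesis
  proof (rule that[of K])
    show "K > 0" using K0(1) d by (simp add: K_def K1_def add_pos_nonneg)
    fix N :: real and \<xi> :: 'a assume N: "N \<ge> 1"
    define M where "M = N powr (1 + \<epsilon>)"
    define z where "z = norm (\<xi> - M *\<^sub>R \<Sum>Basis)"
    define y where "y = (z / N)\<^sup>2"
    define m where "m = norm (M *\<^sub>R \<Sum>Basis :: 'a)"
    have M: "M \<ge> 1" using N \<epsilon> by (simp add: M_def ge_one_powr_ge_zero)
    have m2: "m\<^sup>2 = d * M\<^sup>2"
      unfolding m_def norm_scaleR power_mult_distrib norm_One_power2 d_def by simp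
    have "1\<^sup>2 * M\<^sup>2 \<le> d * M\<^sup>2" using d by (intro mult_right_mono) auto
    then have "M\<^sup>2 \<le> m\<^sup>2" using m2 by simp
    then have mM: "M \<le> m" by (rule power2_le_imp_le) (simp add: m_def)
    have tri: "norm \<xi> \<le> z + m" "m \<le> z + norm \<xi>"
      using norm_triangle_sub[of \<xi> "M *\<^sub>R \<Sum>Basis"] norm_triangle_sub[of "M *\<^sub>R \<Sum>Basis" \<xi>]
      by (auto simp: z_def m_def norm_minus_commute)
    have z0: "z \<ge> 0" by (simp add: z_def)
    define R where "R = (1 + (norm \<xi>)\<^sup>2) / M\<^sup>2"
    \<comment> \<open>\<open>R\<close> is the weight relative to its size at the centre. Near the
      centre it lies between \<open>1 / (4 * d)\<close> and \<open>4 * d\<close>; far away it may be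
      a power of \<open>z\<close> off, which the Gaussian factor repays.\<close>
    have R: "R powr r \<le> K * exp (y / 2)"
    proof (cases "z \<le> m / 2")
      case True
      have n1: "m / 2 \<le> norm \<xi>" using tri True by linarith
      have n2: "norm \<xi> \<le> 3 * m / 2" using tri True by linarith
      have "(m / 2)\<^sup>2 \<le> (norm \<xi>)\<^sup>2" by (rule power_mono[OF n1]) (use mM M in auto)
      then have l: "d * M\<^sup>2 / 4 \<le> (norm \<xi>)\<^sup>2" by (simp add: power_divide m2)
      have "(norm \<xi>)\<^sup>2 \<le> (3 * m / 2)\<^sup>2" by (rule power_mono[OF n2]) auto
      then have u: "(norm \<xi>)\<^sup>2 \<le> 9 / 4 * d * M\<^sup>2" by (simp add: power_divide power_mult_distrib m2)
      have M2: "M\<^sup>2 \<ge> 1" using M by simp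
      have "1 / (4 * d) \<le> 1 / 4" using d by (simp add: field_simps)
      also have "1 / 4 \<le> R"
      proof -
        have "M\<^sup>2 \<le> d * M\<^sup>2" using d by (simp add: mult_le_cancel_right1)
        then have "M\<^sup>2 / 4 \<le> 1 + (norm \<xi>)\<^sup>2" using l by linarith
        then show ?thesis using M by (simp add: R_def field_simps)
      qed
      finally have R1: "1 / (4 * d) \<le> R" .
      have R2: "R \<le> 4 * d"
      proof -
        have "1 \<le> d * M\<^sup>2" using d M2 by (metis mult_mono' mult_1 zero_le_one)
        then have "1 + (norm \<xi>)\<^sup>2 \<le> 4 * d * M\<^sup>2" using u by linarith
        then show ?thesis using M by (simp add: R_def field_simps)
      qed
      have "R powr r \<le> (4 * d) powr \<bar>r\<bar>"
        by (rule powr_le_powr_abs[OF R1 R2]) (use d in simp)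
      also have "\<dots> \<le> K * 1" using K0 by (simp add: K_def K1_def)
      also have "\<dots> \<le> K * exp (y / 2)"
        using \<open>K > 0\<close> by (intro mult_left_mono) (auto simp: y_def)
      finally show ?thesis .
    next
      case False
      then have zM: "M / 2 < z" using mM by linarith
      have zp: "z > 1 / 2" using zM M by linarith
      have yp: "y > 0" using zp N by (simp add: y_def)
      have "norm \<xi> \<le> 3 * z" using tri False by linarith
      then have "(norm \<xi>)\<^sup>2 \<le> (3 * z)\<^sup>2" by (intro power_mono) auto
      moreover have "(1 / 2)\<^sup>2 \<le> z\<^sup>2" using zp by (intro power_mono) auto
      \<comment> \<open>The constant is 4 + 9: \<open>z > 1 / 2\<close> gives
        \<open>1 \<le> 4 * z\<^sup>2\<close>, and \<open>norm \<xi> \<le> 3 * z\<close> gives the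
        rest.\<close>
      ultimately have u: "1 + (norm \<xi>)\<^sup>2 \<le> 13 * z\<^sup>2" by (simp add: power_mult_distrib power2_eq_square)
      have M2: "M\<^sup>2 \<ge> 1" using M by simp
      have L: "13 * z\<^sup>2 \<ge> 1" using \<open>(1 / 2)\<^sup>2 \<le> z\<^sup>2\<close> by (simp add: power2_eq_square)
      have R2: "R \<le> 13 * z\<^sup>2"
      proof -
        have "13 * z\<^sup>2 * 1 \<le> 13 * z\<^sup>2 * M\<^sup>2" using M2 by (intro mult_left_mono) auto
        then have "1 + (norm \<xi>)\<^sup>2 \<le> 13 * z\<^sup>2 * M\<^sup>2" using u by linarith
        then show ?thesis using M by (simp add: R_def field_simps)
      qed
      have R1: "1 / (13 * z\<^sup>2) \<le> R"
      proof -
        have "(M / 2)\<^sup>2 \<le> z\<^sup>2" using zM M by (intro power_mono) auto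
        then have "M\<^sup>2 \<le> 4 * z\<^sup>2" by (simp add: power_divide)
        then have "M\<^sup>2 \<le> 13 * z\<^sup>2" using zero_le_power2[of z] by linarith
        then have "1 / (13 * z\<^sup>2) \<le> 1 / M\<^sup>2"
          using M zp by (intro divide_left_mono mult_pos_pos) auto
        also have "\<dots> \<le> R" unfolding R_def by (intro divide_right_mono) auto
        finally show ?thesis .
      qed
      have "R powr r \<le> (13 * z\<^sup>2) powr \<bar>r\<bar>"
        by (rule powr_le_powr_abs[OF R1 R2 L])
      also have "\<dots> \<le> (13 * (y * (4 * y) powr (1 / \<epsilon>))) powr \<bar>r\<bar>"
      proof (rule powr_mono2)
        \<comment> \<open>The gap between \<open>M\<close> and \<open>N\<close> acts here: a point
          at distance at least \<open>M / 2\<close> is many widths away, so \<open>N\<close> itself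
          is bounded by a power of \<open>y\<close>.\<close>
        have "N powr \<epsilon> \<le> 2 * z / N"
        proof -
          have "M = N * N powr \<epsilon>" using N by (simp add: M_def powr_add)
          then show ?thesis using zM N by (simp add: field_simps)
        qed
        then have "(N powr \<epsilon>)\<^sup>2 \<le> (2 * z / N)\<^sup>2" by (intro power_mono) auto
        also have "\<dots> = 4 * y" by (simp add: y_def power_divide power_mult_distrib)
        finally have "((N powr \<epsilon>)\<^sup>2) powr (1 / \<epsilon>) \<le> (4 * y) powr (1 / \<epsilon>)"
          using \<epsilon> by (intro powr_mono2) auto
        moreover have "((N powr \<epsilon>)\<^sup>2) powr (1 / \<epsilon>) = N\<^sup>2"
        proof -
          have "(N powr \<epsilon>)\<^sup>2 = N powr (2 * \<epsilon>)"
            using N by (simp add: powr_power mult.commute)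
          also have "\<dots> powr (1 / \<epsilon>) = N powr 2" using \<epsilon> by (simp add: powr_powr)
          finally show ?thesis using N by simp
        qed
        ultimately have "N\<^sup>2 \<le> (4 * y) powr (1 / \<epsilon>)" by simp
        then have "y * N\<^sup>2 \<le> y * (4 * y) powr (1 / \<epsilon>)" using yp by (intro mult_left_mono) auto
        moreover have "y * N\<^sup>2 = z\<^sup>2" using N by (simp add: y_def power_divide)
        ultimately show "13 * z\<^sup>2 \<le> 13 * (y * (4 * y) powr (1 / \<epsilon>))" by simp
      qed auto
      also have "\<dots> = (13 * 4 powr (1 / \<epsilon>)) powr \<bar>r\<bar> * y powr A"
      proof -
        have "y * y powr (1 / \<epsilon>) = y powr (1 + 1 / \<epsilon>)" using yp by (simp add: powr_add)
        then have "13 * (y * (4 * y) powr (1 / \<epsilon>)) = (13 * 4 powr (1 / \<epsilon>)) * y powr (1 + 1 / \<epsilon>)"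
          using yp by (simp add: powr_mult mult_ac)
        moreover have "(y powr (1 + 1 / \<epsilon>)) powr \<bar>r\<bar> = y powr A"
          unfolding powr_powr A_def by (simp only: mult.commute)
        ultimately show ?thesis by (simp only: powr_mult)
      qed
      also have "\<dots> \<le> (13 * 4 powr (1 / \<epsilon>)) powr \<bar>r\<bar> * (K0 * exp (y / 2))"
        by (intro mult_left_mono K0 yp) auto
      also have "\<dots> = K1 * exp (y / 2)" by (simp add: K1_def)
      also have "\<dots> \<le> K * exp (y / 2)" by (intro mult_right_mono) (auto simp: K_def)
      finally show ?thesis .
    qed
    have "(1 + (norm \<xi>)\<^sup>2) powr r = (R * M\<^sup>2) powr r" using M by (simp add: R_def)
    also have "\<dots> = R powr r * (M\<^sup>2) powr r"
      by (rule powr_mult)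
    also have "\<dots> \<le> K * exp (y / 2) * (M\<^sup>2) powr r" by (intro mult_right_mono R) auto
    finally show "(1 + (norm \<xi>)\<^sup>2) powr r \<le> K * ((N powr (1 + \<epsilon>))\<^sup>2) powr r *
        exp ((norm (\<xi> - N powr (1 + \<epsilon>) *\<^sub>R \<Sum>Basis))\<^sup>2 / (2 * N\<^sup>2))"
      unfolding M_def[symmetric] z_def[symmetric] y_def by (simp add: power_divide mult_ac)
  qed
qed

text \<open>The square of the Sobolev norm, kept as an extended integral so that estimates avoid
  both the square root and the case of infinite norm.\<close>

definition sobolev_energy :: "real \<Rightarrow> ('a::euclidean_space \<Rightarrow> complex) \<Rightarrow> ennreal" where
  "sobolev_energy s f =
     (\<integral>\<^sup>+ \<xi>. ennreal ((1 + (norm \<xi>)\<^sup>2) powr s * (norm (fourier f \<xi>))\<^sup>2) \<partial>lborel)"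

lemma sobolev_norm_power2: "sobolev_norm s f ^ 2 = sobolev_energy s f"
proof (cases "sobolev_energy s f")
  case (real e)
  then show ?thesis
    unfolding sobolev_norm_def Let_def sobolev_energy_def[symmetric]
    by (simp add: ennreal_power)
next
  case top
  then show ?thesis
    unfolding sobolev_norm_def Let_def sobolev_energy_def[symmetric] by (simp add: power2_eq_square)
qed

text \<open>Freezing the weight uses half of the decay of the squared transform. The other half
  integrates to order \<open>N ^ d\<close>, against a squared prefactor of order \<open>N\<close> to
  the power \<open>- 2 * d\<close>, where \<open>d\<close> is the dimension.\<close>

lemma sobolev_energy_test_datum_le:
  assumes \<epsilon>: "\<epsilon> > 0"
  obtains K where "K > 0"
    "\<And>N. N \<ge> 1 \<Longrightarrow> sobolev_energy r (test_datum N (N powr (1 + \<epsilon>)) :: 'a::euclidean_space \<Rightarrow> complex)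
       \<le> ennreal (K * N powr (2 * (1 + \<epsilon>) * r - real DIM('a)))"
proof -
  obtain K where K: "K > 0"
    "\<And>N \<xi>. N \<ge> 1 \<Longrightarrow> (1 + (norm (\<xi>::'a))\<^sup>2) powr r \<le>
       K * ((N powr (1 + \<epsilon>))\<^sup>2) powr r * exp ((norm (\<xi> - N powr (1 + \<epsilon>) *\<^sub>R \<Sum>Basis))\<^sup>2 / (2 * N\<^sup>2))"
    using sobolev_weight_le[OF \<epsilon>] by blast
  show ?thesis
  proof (rule that[of "K * sqrt (2 * pi) ^ DIM('a)"])
    show "K * sqrt (2 * pi) ^ DIM('a) > 0" using K(1) by simp
    fix N :: real assume N: "N \<ge> 1"
    define M where "M = N powr (1 + \<epsilon>)"
    define g where "g = (\<lambda>\<xi>::'a. exp (- (1 / (2 * N\<^sup>2)) * (norm (\<xi> - M *\<^sub>R \<Sum>Basis))\<^sup>2))"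
    define C where "C = K * (M\<^sup>2) powr r * ((1 / N) ^ DIM('a))\<^sup>2"
    have C: "C \<ge> 0" using K(1) by (simp add: C_def)
    have pw: "(1 + (norm \<xi>)\<^sup>2) powr r * (norm (fourier (test_datum N M) \<xi>))\<^sup>2 \<le> C * g \<xi>" for \<xi>
    proof -
      define y where "y = (norm (\<xi> - M *\<^sub>R \<Sum>Basis))\<^sup>2 / (2 * N\<^sup>2)"
      have "(norm (fourier (test_datum N M) \<xi>))\<^sup>2 = ((1 / N) ^ DIM('a))\<^sup>2 * (exp (- y))\<^sup>2"
        using N by (simp only: norm_fourier_test_datum y_def power_mult_distrib)
      then have "(1 + (norm \<xi>)\<^sup>2) powr r * (norm (fourier (test_datum N M) \<xi>))\<^sup>2
         \<le> (K * (M\<^sup>2) powr r * exp y) * (((1 / N) ^ DIM('a))\<^sup>2 * (exp (- y))\<^sup>2)"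
        using K(2)[OF N, of \<xi>] unfolding M_def[symmetric] y_def[symmetric]
        by (simp only:) (intro mult_right_mono; simp)
      also have "\<dots> = C * (exp y * exp (- y) * exp (- y))"
        by (simp add: C_def power2_eq_square)
      also have "exp y * exp (- y) * exp (- y) = g \<xi>"
        by (simp add: g_def y_def flip: exp_add)
      finally show ?thesis .
    qed
    have "1 / (2 * N\<^sup>2) > 0" using N by simp
    note gi = integrable_exp_norm_diff[OF this, of M, where 'a = 'a, folded g_def]
      integral_exp_norm_diff[OF this, of M, where 'a = 'a, folded g_def]
    have "sobolev_energy r (test_datum N M :: 'a \<Rightarrow> complex) \<le> (\<integral>\<^sup>+\<xi>. ennreal (C * g \<xi>) \<partial>lborel)"
      unfolding sobolev_energy_def by (intro nn_integral_mono ennreal_leI pw)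
    also have "\<dots> = ennreal (LBINT \<xi>. C * g \<xi>)"
      by (rule nn_integral_eq_integral) (use gi C in \<open>auto simp: g_def\<close>)
    also have "(LBINT \<xi>. C * g \<xi>) = C * sqrt (pi / (1 / (2 * N\<^sup>2))) ^ DIM('a)"
      using gi(2) by simp
    also have "\<dots> = K * sqrt (2 * pi) ^ DIM('a) * N powr (2 * (1 + \<epsilon>) * r - real DIM('a))"
    proof -
      have 1: "sqrt (pi / (1 / (2 * N\<^sup>2))) = sqrt (2 * pi) * N"
        using N by (simp add: real_sqrt_mult)
      have "M\<^sup>2 = N powr (2 * (1 + \<epsilon>))" using N by (simp add: M_def powr_power mult.commute)
      then have 2: "(M\<^sup>2) powr r = N powr (2 * (1 + \<epsilon>) * r)" by (simp add: powr_powr)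
      have "((1 / N) ^ DIM('a))\<^sup>2 * N ^ DIM('a) = (1 / N) ^ DIM('a)"
        using N by (simp add: power2_eq_square power_one_over)
      also have "\<dots> = N powr (- real DIM('a))"
        using N by (simp add: powr_minus powr_realpow power_one_over inverse_eq_divide)
      finally have 3: "((1 / N) ^ DIM('a))\<^sup>2 * N ^ DIM('a) = N powr (- real DIM('a))" .
      have "C * (sqrt (2 * pi) * N) ^ DIM('a) = K * sqrt (2 * pi) ^ DIM('a) *
         (N powr (2 * (1 + \<epsilon>) * r) * (((1 / N) ^ DIM('a))\<^sup>2 * N ^ DIM('a)))"
        unfolding C_def 2 power_mult_distrib by (simp only: mult_ac)
      then show ?thesis unfolding 1 3 by (simp add: powr_add[symmetric])
    qed
    finally show "sobolev_energy r (test_datum N (N powr (1 + \<epsilon>)) :: 'a \<Rightarrow> complex)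
       \<le> ennreal (K * sqrt (2 * pi) ^ DIM('a) * N powr (2 * (1 + \<epsilon>) * r - real DIM('a)))"
      unfolding M_def .
  qed
qed

section \<open>Failure of boundedness\<close>

text \<open>The power \<open>p + 1\<close> is the modulus of the nonlinearity, again a Gaussian
  family, so the common majorant applies.\<close>

lemma integrable_power_schroedinger:
  fixes \<phi> :: "'a::euclidean_space \<Rightarrow> complex"
  assumes "gauss_family (\<lambda>_::real. \<phi>)"
  shows "integrable (phase_measure \<gamma> t) (\<lambda>r. LBINT x. norm (schroedinger r \<phi> x) ^ (p + 1))"
proof -
  let ?\<nu> = "phase_measure \<gamma> t"
  interpret finite_measure ?\<nu> by (rule finite_measure_phase_measure)
  interpret pair_sigma_finite ?\<nu> "lborel :: 'a measure" ..
  have u: "gauss_family (\<lambda>r. schroedinger r \<phi>)"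
    by (intro gauss_family_schroedinger assms continuous_intros)
  have f: "gauss_family (\<lambda>r. power_nonlinearity p (schroedinger r \<phi>))"
    by (intro gauss_family_power_nonlinearity u)
  note [measurable] = measurable_gauss_family[OF u]
  have "integrable (?\<nu> \<Otimes>\<^sub>M lborel) (\<lambda>z. complex_of_real (norm (schroedinger (fst z) \<phi> (snd z)) ^ (p + 1)))"
    by (rule integrable_pair_gauss_family[OF f compact_Icc finite_measure_phase_measure
          sets_phase_measure AE_phase_measure, where B = 1])
       (auto simp: power_nonlinearity_def norm_mult norm_power)
  from integrable_fst'[OF this]
  show ?thesis
    by (simp only: fst_conv snd_conv integral_complex_of_real complex_of_real_integrable_eq)
qed

text \<open>A Chebyshev-type bound: the space integral is nonnegative and is bounded below on the
  window. \<open>N \<ge> 2\<close> puts the window within the range of the strip estimate, and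
  \<open>T / 2\<close> replaces \<open>\<bar>t\<bar>\<close> to make the bound uniform in
  \<open>t\<close>.\<close>

lemma pairing_lower_bound:
  fixes N M T \<gamma> t :: real
  assumes N: "N \<ge> 2" and t: "\<gamma> * t < 0" "T / 2 \<le> \<bar>t\<bar>"
  shows "((1 / sqrt (sqrt 5)) ^ DIM('a)) ^ (p + 2) * sqrt (2 * pi / real (p + 2)) ^ DIM('a) *
      (1 / N) ^ DIM('a) * (min (T / 2) (1 / (2 * \<bar>\<gamma>\<bar>)) * (1 / N\<^sup>2))
    \<le> (\<integral>r. (LBINT x::'a::euclidean_space. norm (schroedinger r (test_datum N M) x) ^ (p + 2)) \<partial>phase_measure \<gamma> t)"
proof -
  let ?\<nu> = "phase_measure \<gamma> t"
  interpret finite_measure ?\<nu> by (rule finite_measure_phase_measure)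
  define E where "E = (\<lambda>r. LBINT x::'a. norm (schroedinger r (test_datum N M) x) ^ (p + 2))"
  define \<delta> where "\<delta> = 1 / N\<^sup>2"
  define c where "c = ((1 / sqrt (sqrt 5)) ^ DIM('a)) ^ (p + 2) * sqrt (2 * pi / real (p + 2)) ^ DIM('a) *
      (1 / N) ^ DIM('a)"
  have c: "c \<ge> 0" using N by (simp add: c_def)
  have "N\<^sup>2 \<ge> 2\<^sup>2" using N by (intro power_mono) auto
  then have \<delta>: "0 < \<delta>" "\<delta> \<le> 1 / 2" using N by (auto simp: \<delta>_def divide_le_eq)
  have gf: "gauss_family (\<lambda>_::real. test_datum N M :: 'a \<Rightarrow> complex)"
    using N by (intro gauss_family_test_datum) simp
  have E: "integrable ?\<nu> E"
    \<comment> \<open>Instantiated with \<open>p + 1\<close>, which yields the power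
      \<open>p + 2\<close> of the pairing.\<close>
    using integrable_power_schroedinger[OF gf, of _ _ "p + 1"] by (simp add: E_def)
  have "c * (min (T / 2) (1 / (2 * \<bar>\<gamma>\<bar>)) * \<delta>) \<le> c * measure ?\<nu> {- \<delta>..\<delta>}"
  proof (rule mult_left_mono[OF _ c])
    have "min (T / 2) (1 / (2 * \<bar>\<gamma>\<bar>)) * \<delta> \<le> min \<bar>t\<bar> (1 / (2 * \<bar>\<gamma>\<bar>)) * \<delta>"
      using t(2) \<delta>(1) by (intro mult_right_mono) auto
    also have "\<dots> \<le> measure ?\<nu> {- \<delta>..\<delta>}"
      by (rule measure_phase_measure_ge[OF t(1) \<delta>])
    finally show "min (T / 2) (1 / (2 * \<bar>\<gamma>\<bar>)) * \<delta> \<le> measure ?\<nu> {- \<delta>..\<delta>}" .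
  qed
  also have "\<dots> = (\<integral>r. c * indicator {- \<delta>..\<delta>} r \<partial>?\<nu>)"
    by simp
  also have "\<dots> \<le> (\<integral>r. E r \<partial>?\<nu>)"
  proof (rule integral_mono[OF _ E])
    show "integrable ?\<nu> (\<lambda>r. c * indicator {- \<delta>..\<delta>} r)"
      by (intro integrable_mult_right integrable_real_indicator) (auto simp: emeasure_eq_measure)
    show "c * indicator {- \<delta>..\<delta>} r \<le> E r" for r
    proof (cases "r \<in> {- \<delta>..\<delta>}")
      case True
      then have "\<bar>r\<bar> * N\<^sup>2 \<le> 1" using N by (auto simp: \<delta>_def field_simps abs_if)
      then show ?thesis
        using power_integral_schroedinger_test_datum_ge[of N r "p + 2" M, where 'a = 'a] N True
        by (simp add: c_def E_def)
    next
      case False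
      then show ?thesis by (simp add: E_def)
    qed
  qed
  finally show ?thesis unfolding c_def \<delta>_def E_def .
qed

text \<open>Duality of \<open>H^s\<close> and \<open>H^(-s)\<close>: Cauchy-Schwarz after inserting
  the weight with exponents \<open>s / 2\<close> and \<open>- s / 2\<close>.\<close>

lemma norm_integral_power2_le_energies:
  fixes f \<phi> :: "'a::euclidean_space \<Rightarrow> complex"
  assumes [measurable]: "fourier f \<in> borel_measurable borel" "fourier \<phi> \<in> borel_measurable borel"
    and k: "\<And>\<xi>. norm (k \<xi>) = norm (fourier \<phi> \<xi>)"
  shows "ennreal ((norm (LBINT \<xi>. fourier f \<xi> * k \<xi>))\<^sup>2) \<le> sobolev_energy s f * sobolev_energy (- s) \<phi>"
proof -
  have "ennreal (norm (LBINT \<xi>. fourier f \<xi> * k \<xi>)) \<le> (\<integral>\<^sup>+ \<xi>. norm (fourier f \<xi> * k \<xi>) \<partial>lborel)"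
  \<comment> \<open>If the pairing is not integrable, its Bochner integral is 0 and the bound is
    trivial.\<close>
  proof (cases "integrable lborel (\<lambda>\<xi>. fourier f \<xi> * k \<xi>)")
    case True
    then show ?thesis by (rule integral_norm_bound_ennreal)
  qed (simp add: not_integrable_integral_eq)
  also have "\<dots> = (\<integral>\<^sup>+ \<xi>. ennreal ((1 + (norm \<xi>)\<^sup>2) powr (s / 2) * norm (fourier f \<xi>)) *
      ennreal ((1 + (norm \<xi>)\<^sup>2) powr (- s / 2) * norm (fourier \<phi> \<xi>)) \<partial>lborel)"
  proof (rule nn_integral_cong)
    fix \<xi> :: 'a
    have p: "1 + (norm \<xi>)\<^sup>2 > 0" by (simp add: add_pos_nonneg)
    have "(1 + (norm \<xi>)\<^sup>2) powr (s / 2) * (1 + (norm \<xi>)\<^sup>2) powr (- s / 2) = 1"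
      using p by (simp flip: powr_add)
    then have "norm (fourier f \<xi> * k \<xi>) = ((1 + (norm \<xi>)\<^sup>2) powr (s / 2) * norm (fourier f \<xi>)) *
       ((1 + (norm \<xi>)\<^sup>2) powr (- s / 2) * norm (fourier \<phi> \<xi>))"
      unfolding norm_mult k by (metis (no_types, lifting) mult.commute mult.left_commute mult_1)
    then show "ennreal (norm (fourier f \<xi> * k \<xi>)) = ennreal ((1 + (norm \<xi>)\<^sup>2) powr (s / 2) * norm (fourier f \<xi>)) *
      ennreal ((1 + (norm \<xi>)\<^sup>2) powr (- s / 2) * norm (fourier \<phi> \<xi>))"
      by (simp only: ennreal_mult mult_nonneg_nonneg powr_ge_zero norm_ge_zero)
  qed
  finally have "(ennreal (norm (LBINT \<xi>. fourier f \<xi> * k \<xi>)))\<^sup>2 \<le> \<dots>\<^sup>2"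
    by (rule power_mono) simp
  also have "\<dots> \<le> (\<integral>\<^sup>+ \<xi>. ennreal ((1 + (norm \<xi>)\<^sup>2) powr (s / 2) * norm (fourier f \<xi>)) ^ 2 \<partial>lborel) *
      (\<integral>\<^sup>+ \<xi>. ennreal ((1 + (norm \<xi>)\<^sup>2) powr (- s / 2) * norm (fourier \<phi> \<xi>)) ^ 2 \<partial>lborel)"
    by (rule Cauchy_Schwarz_nn_integral) measurable
  also have "\<dots> = sobolev_energy s f * sobolev_energy (- s) \<phi>"
  proof -
    have "ennreal ((1 + (norm \<xi>)\<^sup>2) powr (r / 2) * n) ^ 2 = ennreal ((1 + (norm \<xi>)\<^sup>2) powr r * n\<^sup>2)"
      if "n \<ge> 0" for n r :: real and \<xi> :: 'a
    proof -
      have "((1 + (norm \<xi>)\<^sup>2) powr (r / 2))\<^sup>2 = (1 + (norm \<xi>)\<^sup>2) powr r"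
        by (simp add: power2_eq_square flip: powr_add)
      then show ?thesis using that by (simp add: ennreal_power power_mult_distrib)
    qed
    from this[where r = s] this[where r = "- s"] show ?thesis
      unfolding sobolev_energy_def by simp
  qed
  finally show ?thesis by (simp add: ennreal_power)
qed

text \<open>The essential supremum controls almost every time only, so a good time is taken from an
  interval of positive length. Staying at distance \<open>T / 2\<close> from 0 matters because the
  chosen time will vary with \<open>N\<close>.\<close>

lemma Linf_sobolev_norm_le_imp_exists:
  assumes "Linf_sobolev_norm T s u \<le> B" and T: "T > 0" and \<gamma>: "\<gamma> \<noteq> 0"
  obtains t where "\<gamma> * t < 0" "T / 2 \<le> \<bar>t\<bar>" "sobolev_norm s (u t) \<le> B"
proof -
  define J where "J = (if \<gamma> > 0 then {- T<..<- (T / 2)} else {T / 2<..<T})"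
  let ?M = "restrict_space lborel {-T<..<T}"
  have ae: "AE t in ?M. sobolev_norm s (u t) \<le> B"
    using esssup_AE[of "\<lambda>t. sobolev_norm s (u t)" ?M] assms(1)
    unfolding Linf_sobolev_norm_def[symmetric] by (auto elim: order_trans)
  have "\<exists>t\<in>J. sobolev_norm s (u t) \<le> B"
  proof (rule ccontr)
    assume no: "\<not> (\<exists>t\<in>J. sobolev_norm s (u t) \<le> B)"
    have "AE t in ?M. t \<notin> J"
      using ae no by (auto elim!: eventually_mono)
    then have "AE t in lborel. t \<in> {-T<..<T} \<longrightarrow> t \<notin> J"
      by (subst (asm) AE_restrict_space_iff) auto
    then have "AE t in lborel. t \<notin> J"
      by (rule eventually_mono) (use T in \<open>auto simp: J_def split: if_splits\<close>)
    then have "emeasure lborel J = 0"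
      by (subst (asm) AE_iff_measurable[where N = J]) (auto simp: J_def)
    then show False using T by (auto simp: J_def split: if_splits)
  qed
  then obtain t where t: "t \<in> J" "sobolev_norm s (u t) \<le> B" by blast
  have "\<gamma> * t < 0" "T / 2 \<le> \<bar>t\<bar>"
    using t(1) T \<gamma> by (auto simp: J_def mult_less_0_iff split: if_splits)
  then show ?thesis using t(2) that by blast
qed

text \<open>Half of the gap between \<open>s\<close> and \<kappa> is spent on \<epsilon>; adding 1
  to \<open>\<bar>s\<bar>\<close> keeps the denominator positive at \<open>s = 0\<close>.\<close>

lemma exists_dilation_exponent:
  fixes s \<kappa> :: real
  assumes "s < \<kappa>"
  obtains \<epsilon> where "\<epsilon> > 0" "(1 + \<epsilon>) * s < \<kappa>"
proof (rule that[of "(\<kappa> - s) / (2 * (\<bar>s\<bar> + 1))"])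
  define \<epsilon> where "\<epsilon> = (\<kappa> - s) / (2 * (\<bar>s\<bar> + 1))"
  show "(\<kappa> - s) / (2 * (\<bar>s\<bar> + 1)) > 0" using assms by simp
  then have \<epsilon>: "\<epsilon> > 0" by (simp add: \<epsilon>_def)
  have "\<epsilon> * s \<le> \<epsilon> * (\<bar>s\<bar> + 1)" using \<epsilon> by (intro mult_left_mono) auto
  also have "\<dots> = (\<kappa> - s) / 2" by (simp add: \<epsilon>_def field_simps)
  finally show "(1 + (\<kappa> - s) / (2 * (\<bar>s\<bar> + 1))) * s < \<kappa>"
    using assms unfolding \<epsilon>_def[symmetric] by (simp add: algebra_simps)
qed

theorem theorem1p2:
  fixes p :: nat and \<gamma> T s :: real
  assumes "p \<ge> 2" and "even p" and "\<gamma> \<noteq> 0" and "T > 0"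
    and "s < real CARD('n::finite) / 2 - 2 / real p"
  shows "\<not> (\<exists>C::real. \<forall>\<phi> :: real^'n \<Rightarrow> complex. schwartz \<phi> \<longrightarrow>
           Linf_sobolev_norm T s (Xi1 \<gamma> p \<phi>) \<le> ennreal C * sobolev_norm s \<phi> ^ (p + 1))"
proof
  assume "\<exists>C::real. \<forall>\<phi> :: real^'n \<Rightarrow> complex. schwartz \<phi> \<longrightarrow>
           Linf_sobolev_norm T s (Xi1 \<gamma> p \<phi>) \<le> ennreal C * sobolev_norm s \<phi> ^ (p + 1)"
  then obtain C0 where C0: "\<And>\<phi> :: real^'n \<Rightarrow> complex. schwartz \<phi> \<Longrightarrow>
           Linf_sobolev_norm T s (Xi1 \<gamma> p \<phi>) \<le> ennreal C0 * sobolev_norm s \<phi> ^ (p + 1)" by blast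
  \<comment> \<open>\<open>ennreal\<close> sends negative reals to 0, so this replacement leaves the
    assumed bound unchanged.\<close>
  define C where "C = max C0 0"
  have C: "C \<ge> 0" "ennreal C0 = ennreal C"
    by (auto simp: C_def max_def ennreal_neg)
  define d where "d = CARD('n)"
  have dim: "DIM(real^'n) = d" by (simp add: d_def)
  obtain \<epsilon> where \<epsilon>: "\<epsilon> > 0" "(1 + \<epsilon>) * s < real d / 2 - 2 / real p"
    using exists_dilation_exponent[OF assms(5)] unfolding d_def by blast
  obtain K1 where K1: "K1 > 0"
    "\<And>N. N \<ge> 1 \<Longrightarrow> sobolev_energy s (test_datum N (N powr (1 + \<epsilon>)) :: real^'n \<Rightarrow> complex)
       \<le> ennreal (K1 * N powr (2 * (1 + \<epsilon>) * s - real d))"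
    using sobolev_energy_test_datum_le[OF \<epsilon>(1), of s, where 'a = "real^'n"] unfolding dim by blast
  obtain K2 where K2: "K2 > 0"
    "\<And>N. N \<ge> 1 \<Longrightarrow> sobolev_energy (- s) (test_datum N (N powr (1 + \<epsilon>)) :: real^'n \<Rightarrow> complex)
       \<le> ennreal (K2 * N powr (2 * (1 + \<epsilon>) * (- s) - real d))"
    using sobolev_energy_test_datum_le[OF \<epsilon>(1), of "- s", where 'a = "real^'n"] unfolding dim by blast
  define c where "c = ((1 / sqrt (sqrt 5)) ^ d) ^ (p + 2) * sqrt (2 * pi / real (p + 2)) ^ d *
      min (T / 2) (1 / (2 * \<bar>\<gamma>\<bar>))"
  have c: "c > 0" using assms(3,4) by (simp add: c_def)
  \<comment> \<open>The exponent of \<open>N\<close> left over after squaring: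
    \<open>- 2 * d - 4\<close> from the lower bound, minus
    \<open>(p + 1) * (2 * (1 + \<epsilon>) * s - d)\<close> and minus
    \<open>- 2 * (1 + \<epsilon>) * s - d\<close> from the two energies.\<close>
  define \<kappa> where "\<kappa> = real p * (real d - 4 / real p - 2 * (1 + \<epsilon>) * s)"
  have \<kappa>: "\<kappa> > 0"
  proof -
    have "4 / real p = 2 * (2 / real p)" "2 * (1 + \<epsilon>) * s = 2 * ((1 + \<epsilon>) * s)" by simp_all
    then have "real d - 4 / real p - 2 * (1 + \<epsilon>) * s > 0" using \<epsilon>(2) by linarith
    then show ?thesis using assms(1) by (simp add: \<kappa>_def)
  qed
  have main: "c\<^sup>2 * N powr \<kappa> \<le> C\<^sup>2 * K1 ^ (p + 1) * K2" if N: "N \<ge> 2" for N :: real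
  proof -
    define \<phi> :: "real^'n \<Rightarrow> complex" where "\<phi> = test_datum N (N powr (1 + \<epsilon>))"
    have N0: "N > 0" "N \<ge> 1" using N by auto
    have gf: "gauss_family (\<lambda>_::real. \<phi>)"
      unfolding \<phi>_def by (rule gauss_family_test_datum[OF N0(1)])
    have sch: "schwartz \<phi>" unfolding \<phi>_def by (rule schwartz_test_datum[OF N0(1)])
    \<comment> \<open>This time depends on \<open>N\<close>, but the lower bound for the pairing is
      the same for all such times.\<close>
    obtain t where t: "\<gamma> * t < 0" "T / 2 \<le> \<bar>t\<bar>"
      "sobolev_norm s (Xi1 \<gamma> p \<phi> t) \<le> ennreal C * sobolev_norm s \<phi> ^ (p + 1)"
      using Linf_sobolev_norm_le_imp_exists[OF C0[OF sch] assms(4,3)] unfolding C(2) by blast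
    define P where "P = (\<integral>r. (LBINT x. norm (schroedinger r \<phi> x) ^ (p + 2)) \<partial>phase_measure \<gamma> t)"
    define b where "b = c * (1 / N) ^ d * (1 / N\<^sup>2)"
    have b: "b > 0" using c N0 by (simp add: b_def)
    have bP: "b \<le> P"
      using pairing_lower_bound[OF N t(1,2), where 'a = "real^'n" and p = p and M = "N powr (1 + \<epsilon>)"]
      unfolding P_def \<phi>_def b_def c_def dim by (simp only: mult_ac)
    have "t \<noteq> 0" using t(1) by auto
    define k where "k = (\<lambda>\<xi>. cnj (cis (- (\<gamma> * t) * (norm \<xi>)\<^sup>2) * fourier \<phi> \<xi>))"
    have "norm (LBINT \<xi>. fourier (Xi1 \<gamma> p \<phi> t) \<xi> * k \<xi>) = \<bar>P\<bar>"
      unfolding k_def Xi1_gauss_pairing[OF gf] P_def using \<open>t \<noteq> 0\<close> by (simp add: norm_mult)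
    also have "\<dots> = P" using bP b by simp
    finally have P: "norm (LBINT \<xi>. fourier (Xi1 \<gamma> p \<phi> t) \<xi> * k \<xi>) = P" .
    have k: "norm (k \<xi>) = norm (fourier \<phi> \<xi>)" for \<xi>
      by (simp add: k_def norm_mult)
    have "fourier \<phi> \<in> borel_measurable borel"
      using integrable_gauss_family[OF gauss_family_fourier[OF gf]] by (simp add: borel_measurable_integrable)
    from norm_integral_power2_le_energies[where f = "Xi1 \<gamma> p \<phi> t" and s = s,
        OF measurable_fourier_Xi1_gauss[OF gf] this k]
    have "ennreal (P\<^sup>2) \<le> sobolev_energy s (Xi1 \<gamma> p \<phi> t) * sobolev_energy (- s) \<phi>"
      unfolding P .
    also have "\<dots> \<le> (ennreal C * sobolev_norm s \<phi> ^ (p + 1)) ^ 2 * sobolev_energy (- s) \<phi>"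
      unfolding sobolev_norm_power2[symmetric, of _ "Xi1 \<gamma> p \<phi> t"]
      by (intro mult_right_mono power_mono t(3)) auto
    also have "(ennreal C * sobolev_norm s \<phi> ^ (p + 1)) ^ 2 = ennreal (C\<^sup>2) * sobolev_energy s \<phi> ^ (p + 1)"
      unfolding sobolev_norm_power2[symmetric] using C(1)
      by (simp add: power_mult_distrib ennreal_power power_mult[symmetric] mult.commute del: power_Suc)
    also have "ennreal (C\<^sup>2) * sobolev_energy s \<phi> ^ (p + 1) * sobolev_energy (- s) \<phi>
       \<le> ennreal (C\<^sup>2) * ennreal (K1 * N powr (2 * (1 + \<epsilon>) * s - real d)) ^ (p + 1) *
          ennreal (K2 * N powr (2 * (1 + \<epsilon>) * (- s) - real d))"
      unfolding \<phi>_def by (intro mult_mono power_mono mult_left_mono K1(2) K2(2) N0) auto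
    also have "\<dots> = ennreal (C\<^sup>2 * (K1 * N powr (2 * (1 + \<epsilon>) * s - real d)) ^ (p + 1) *
          (K2 * N powr (2 * (1 + \<epsilon>) * (- s) - real d)))"
    proof -
      have "ennreal (C\<^sup>2) * ennreal A ^ (p + 1) * ennreal B = ennreal (C\<^sup>2 * A ^ (p + 1) * B)"
        if "A \<ge> 0" "B \<ge> 0" for A B
        using that by (simp add: ennreal_mult ennreal_power del: power_Suc)
      then show ?thesis using K1(1) K2(1) by simp
    qed
    finally have "P\<^sup>2 \<le> C\<^sup>2 * (K1 * N powr (2 * (1 + \<epsilon>) * s - real d)) ^ (p + 1) *
          (K2 * N powr (2 * (1 + \<epsilon>) * (- s) - real d))"
      using K1(1) K2(1) by (subst (asm) ennreal_le_iff) auto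
    moreover have "b\<^sup>2 \<le> P\<^sup>2" using b bP by (intro power_mono) auto
    ultimately have *: "b\<^sup>2 \<le> C\<^sup>2 * (K1 * N powr (2 * (1 + \<epsilon>) * s - real d)) ^ (p + 1) *
          (K2 * N powr (2 * (1 + \<epsilon>) * (- s) - real d))" by linarith
    have b2: "b\<^sup>2 = c\<^sup>2 * N powr (- 2 * real d - 4)"
    proof -
      have "(1 / N) ^ d * (1 / N\<^sup>2) = N powr (- real (d + 2))"
        using N0 by (simp only: powr_minus powr_realpow) (simp add: power_add power2_eq_square field_simps)
      then have "b = c * N powr (- real (d + 2))" by (simp only: b_def mult.assoc)
      then show ?thesis using N0
        by (simp add: power_mult_distrib powr_power algebra_simps)
    qed
    define x where "x = 2 * (1 + \<epsilon>) * s - real d"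
    have rhs: "C\<^sup>2 * (K1 * N powr x) ^ (p + 1) * (K2 * N powr (2 * (1 + \<epsilon>) * (- s) - real d))
       = C\<^sup>2 * K1 ^ (p + 1) * K2 * N powr (x * real (p + 1) + (2 * (1 + \<epsilon>) * (- s) - real d))"
      using N0 by (simp add: power_mult_distrib powr_power powr_add mult_ac del: power_Suc)
    have "c\<^sup>2 * N powr \<kappa> = c\<^sup>2 * N powr (- 2 * real d - 4) *
        N powr (- (x * real (p + 1) + (2 * (1 + \<epsilon>) * (- s) - real d)))"
    proof -
      have "\<kappa> = (- 2 * real d - 4) + (- (x * real (p + 1) + (2 * (1 + \<epsilon>) * (- s) - real d)))"
        using assms(1) by (simp add: \<kappa>_def x_def field_simps)
      then show ?thesis by (simp only: powr_add mult.assoc)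
    qed
    also have "\<dots> \<le> C\<^sup>2 * K1 ^ (p + 1) * K2 * N powr (x * real (p + 1) + (2 * (1 + \<epsilon>) * (- s) - real d)) *
        N powr (- (x * real (p + 1) + (2 * (1 + \<epsilon>) * (- s) - real d)))"
      using *[unfolded b2 x_def[symmetric] rhs] by (rule mult_right_mono) simp
    also have "\<dots> = C\<^sup>2 * K1 ^ (p + 1) * K2"
      using N0 by (simp only: mult.assoc powr_add[symmetric]) simp
    finally show ?thesis .
  qed
  \<comment> \<open>The left side of \<open>main\<close> is unbounded in \<open>N\<close>, whereas
    its right side does not depend on \<open>N\<close>.\<close>
  have "filterlim (\<lambda>N. c\<^sup>2 * N powr \<kappa>) at_top at_top"
    using c \<kappa> by real_asymp
  then have "eventually (\<lambda>N. c\<^sup>2 * N powr \<kappa> > C\<^sup>2 * K1 ^ (p + 1) * K2) at_top"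
    by (simp add: filterlim_at_top_dense)
  then have "eventually (\<lambda>N::real. False) at_top"
    using eventually_ge_at_top[of 2] by eventually_elim (use main in force)
  then show False by simp
qed

end
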